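(* Let $N_0,N_1\ge 1$ be integers, let $\Sigma_x\in\mathbb{R}^{N_0\times N_0}$ be positive definite with eigenvalues $\lambda^x_1\ge \lambda^x_2\ge\cdots\ge\lambda^x_{N_0}>0$, and let $\sigma^2>0$. Let $X\sim\mathcal{N}(0;\Sigma_x)$, and for $W\in\mathbb{R}^{N_1\times N_0}$, $b\in\mathbb{R}^{N_1}$ let $Z\in\mathbb{R}^{N_1}$ satisfy $Z\mid X,W,b\sim\mathcal{N}(WX+b;\,\sigma^2 I_{N_1})$. Let $\tilde N=\min(N_0,N_1)$ and let $F\ge\rho_{\tilde N}$. Then $$\mathrm{MMI}(X;Z)=\frac{\tilde N}{2}\log\!\left(\frac{F+\sigma^2\,\mathrm{Tr}(\Sigma_{x,\tilde N}^{-1})}{\sigma^2\tilde N}\right)+\frac12\log|\Sigma_{x,\tilde N}|.$$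
   Context: $\mathcal{N}(\mu;A)$ denotes the Gaussian distribution with mean $\mu$ and covariance $A$; $I_{N_1}$ is the $N_1\times N_1$ identity; logarithms are natural and $|\cdot|$ denotes determinant. For $k=1,\dots,\tilde N$, $\Sigma_{x,k}$ is the $k\times k$ diagonal matrix $\mathrm{diag}(\lambda^x_1,\dots,\lambda^x_k)$ of the $k$ largest eigenvalues of $\Sigma_x$, and $\rho_k\triangleq\sigma^2\left(\frac{k}{\lambda^x_k}-\mathrm{Tr}(\Sigma_{x,k}^{-1})\right)=\sigma^2\left(\frac{k}{\lambda^x_k}-\sum_{i=1}^k\frac{1}{\lambda^x_i}\right)$. $I_{W,b}(X;Z)$ is the mutual information between $X$ and $Z$ under the joint law determined by $W,b$, and $\mathrm{MMI}(X;Z)\triangleq\sup\{I_{W,b}(X;Z): W\in\mathbb{R}^{N_1\times N_0},\ b\in\mathbb{R}^{N_1},\ \mathrm{Tr}(W^TW)\le F\}$. *)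

theory Defs
  imports "HOL-Probability.Probability"
begin

definition pos_def_matrix :: "real^'n^'n \<Rightarrow> bool" where
  "pos_def_matrix A \<longleftrightarrow> transpose A = A \<and> (\<forall>x. x \<noteq> 0 \<longrightarrow> x \<bullet> (A *v x) > 0)"

definition gauss_density :: "real^'n^'n \<Rightarrow> real^'n \<Rightarrow> real^'n \<Rightarrow> real" where
  "gauss_density A mu x =
     exp (- (1/2) * ((x - mu) \<bullet> (matrix_inv A *v (x - mu))))
       / sqrt ((2 * pi) ^ CARD('n) * det A)"

definition joint_law ::
  "real^'n^'n \<Rightarrow> real \<Rightarrow> real^'n^'m \<Rightarrow> real^'m \<Rightarrow> ((real^'n) \<times> (real^'m)) measure" where
  "joint_law Sx s2 W b =
     density lborel (\<lambda>(x, z). ennreal (gauss_density Sx 0 x * gauss_density (mat s2) (W *v x + b) z))"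

definition MI_Wb ::
  "real^'n^'n \<Rightarrow> real \<Rightarrow> real^'n^'m \<Rightarrow> real^'m \<Rightarrow> real" where
  "MI_Wb Sx s2 W b =
     prob_space.mutual_information (joint_law Sx s2 W b) (exp 1)
       (lborel :: (real^'n) measure) (lborel :: (real^'m) measure) fst snd"

definition MMI :: "'m::finite itself \<Rightarrow> real^'n^'n \<Rightarrow> real \<Rightarrow> real \<Rightarrow> ereal" where
  "MMI (_ :: 'm::finite itself) Sx s2 F =
     (SUP Wb \<in> {(W :: real^'n^'m, b :: real^'m). trace (transpose W ** W) \<le> F}.
        ereal (MI_Wb Sx s2 (fst Wb) (snd Wb)))"

definition rho :: "real \<Rightarrow> (nat \<Rightarrow> real) \<Rightarrow> nat \<Rightarrow> real" where
  "rho s2 lam k = s2 * (real k / lam k - (\<Sum>i=1..k. 1 / lam i))"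

end

theory Submission
  imports Defs "HOL-Computational_Algebra.Polynomial"
begin

text \<open>
  Completing the square in the joint density shows that \<open>Z\<close> is Gaussian with covariance
  \<open>S = W \<Sigma> W\<^sup>T + \<sigma>\<^sup>2 I\<close>, and the two quadratic forms in the log-likelihood ratio both have
  expectation \<open>N\<^sub>1\<close>, so the mutual information is \<open>1/2 log |S / \<sigma>\<^sup>2|\<close>.

  Let \<open>\<theta>\<close> be the eigenvalues of \<open>W \<Sigma> W\<^sup>T\<close>, so that the determinant ratio is the product of the
  \<open>1 + \<theta>\<^sub>i / \<sigma>\<^sup>2\<close>. Ky Fan's inequality for \<open>\<Sigma>\<^sup>-\<^sup>1\<close> and a rearrangement argument show that
  producing these \<open>\<theta>\<close> costs at least the power \<open>\<Sum> \<theta>\<^sub>j / \<lambda>\<^sub>j\<close>, with the \<open>\<theta>\<^sub>j\<close> suitably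
  assigned to the largest \<open>\<lambda>\<^sub>j\<close>; AM-GM applied to the numbers
  \<open>(1 + \<theta>\<^sub>j / \<sigma>\<^sup>2) / \<lambda>\<^sub>j\<close> gives the upper bound. The lower bound on \<open>F\<close> makes the water-filling
  powers \<open>\<sigma>\<^sup>2 (\<nu> - 1 / \<lambda>\<^sub>j)\<close>, which give equality, nonnegative.
\<close>

section \<open>Spectral theorem for real symmetric matrices\<close>

text \<open>A maximiser \<open>u\<close> of the Rayleigh quotient over the unit sphere of
  \<open>T\<close> is an eigenvector. Working in an invariant subspace rather than the whole space
  lets the argument be repeated on orthogonal complements.\<close>

lemma self_adjoint_eigenvector_exists:
  fixes f :: "'a::euclidean_space \<Rightarrow> 'a"
  assumes lin: "linear f" and sa: "\<And>x y. f x \<bullet> y = x \<bullet> f y"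
    and T: "subspace T" "f ` T \<subseteq> T" "T \<noteq> {0}"
  obtains u \<mu> where "u \<in> T" "norm u = 1" "f u = \<mu> *\<^sub>R u"
proof -
  obtain w where w: "w \<in> T" "w \<noteq> 0"
    using T subspace_0 by blast
  have "compact (T \<inter> sphere 0 1)"
    using closed_subspace[OF T(1)] by (simp add: closed_Int_compact)
  moreover have "(1 / norm w) *\<^sub>R w \<in> T \<inter> sphere 0 1"
    using w T(1) by (auto simp: subspace_scale)
  moreover have "continuous_on (T \<inter> sphere 0 1) (\<lambda>x. x \<bullet> f x)"
    using lin by (intro continuous_intros linear_continuous_on) (simp add: linear_linear)
  ultimately obtain u where "u \<in> T \<inter> sphere 0 1" "\<forall>v\<in>T \<inter> sphere 0 1. v \<bullet> f v \<le> u \<bullet> f u"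
    using continuous_attains_sup[of "T \<inter> sphere 0 1" "\<lambda>x. x \<bullet> f x"] by blast
  then have u: "u \<in> T" "norm u = 1"
      and max: "\<And>v. v \<in> T \<Longrightarrow> norm v = 1 \<Longrightarrow> v \<bullet> f v \<le> u \<bullet> f u"
    by auto
  define \<mu> where "\<mu> = u \<bullet> f u"
  have quad: "v \<bullet> f v \<le> \<mu> * (v \<bullet> v)" if "v \<in> T" for v
  proof (cases "v = 0")
    case True
    then show ?thesis using linear_0[OF lin] by simp
  next
    case False
    have "(1 / norm v) *\<^sub>R v \<bullet> f ((1 / norm v) *\<^sub>R v) \<le> \<mu>"
      unfolding \<mu>_def using False that T(1) by (intro max) (auto simp: subspace_scale)
    then have "(v \<bullet> f v) / (norm v)\<^sup>2 \<le> \<mu>"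
      by (simp add: linear_cmul[OF lin] power2_eq_square)
    then show ?thesis
      using False by (simp add: dot_square_norm pos_divide_le_eq)
  qed
  \<comment> \<open>First variation: moving from \<open>u\<close> in a direction orthogonal to it
    cannot raise the quotient, so the linear term in \<open>t\<close> must vanish.\<close>
  have orth: "v \<bullet> f u = 0" if v: "v \<in> T" "v \<bullet> u = 0" for v
  proof -
    define a b where "a = v \<bullet> f u" and "b = \<mu> * (v \<bullet> v) - v \<bullet> f v"
    have ineq: "2 * t * a \<le> t^2 * b" for t
    proof -
      have "u + t *\<^sub>R v \<in> T"
        using u v T(1) by (simp add: subspace_add subspace_scale)
      from quad[OF this]
      have "(u + t *\<^sub>R v) \<bullet> (f u + t *\<^sub>R f v) \<le> \<mu> * ((u + t *\<^sub>R v) \<bullet> (u + t *\<^sub>R v))"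
        by (simp only: linear_add[OF lin] linear_cmul[OF lin])
      moreover have "(u + t *\<^sub>R v) \<bullet> (f u + t *\<^sub>R f v) = \<mu> + 2 * t * a + t\<^sup>2 * (v \<bullet> f v)"
        using sa[of u v] by (simp add: \<mu>_def a_def inner_simps inner_commute[of _ v] power2_eq_square algebra_simps)
      moreover have "(u + t *\<^sub>R v) \<bullet> (u + t *\<^sub>R v) = 1 + t\<^sup>2 * (v \<bullet> v)"
        using u v by (simp add: inner_simps inner_commute[of u v] dot_square_norm[of u] power2_eq_square)
      ultimately have "\<mu> + 2 * t * a + t\<^sup>2 * (v \<bullet> f v) \<le> \<mu> * (1 + t\<^sup>2 * (v \<bullet> v))"
        by simp
      then show ?thesis by (simp add: b_def algebra_simps)
    qed
    have "b \<ge> 0" using quad[OF v(1)] by (simp add: b_def)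
    \<comment> \<open>The inequality is tested at \<open>t = a / (b + 1)\<close>; the added 1 keeps
      the denominator positive even when \<open>b = 0\<close>.\<close>
    have "a\<^sup>2 * (b + 2) = (b + 1)\<^sup>2 * (2 * (a / (b + 1)) * a - (a / (b + 1))\<^sup>2 * b)"
    proof -
      define c where "c = a / (b + 1)"
      have "a = c * (b + 1)" using \<open>b \<ge> 0\<close> by (simp add: c_def)
      then show ?thesis unfolding c_def[symmetric] by (simp add: algebra_simps power2_eq_square)
    qed
    also have "\<dots> \<le> 0"
      using ineq[of "a / (b + 1)"] by (simp add: mult_le_0_iff)
    finally have "a\<^sup>2 * (b + 2) \<le> 0" .
    then have "a = 0"
      using \<open>b \<ge> 0\<close> by (simp add: mult_le_0_iff)
    then show ?thesis by (simp add: a_def)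
  qed
  \<comment> \<open>The part of \<open>f u\<close> orthogonal to \<open>u\<close>. It lies in
    \<open>T\<close> by invariance, so \<open>orth\<close> makes it orthogonal to \<open>f u\<close>
    as well, hence to itself.\<close>
  define v where "v = f u - \<mu> *\<^sub>R u"
  have "v \<in> T"
    unfolding v_def using T u by (auto intro!: subspace_diff subspace_scale)
  moreover have "v \<bullet> u = 0"
    using u by (simp add: v_def \<mu>_def inner_diff_left dot_square_norm) (simp add: inner_commute)
  ultimately have "v \<bullet> v = 0"
    using orth[of v] by (subst (2) v_def) (simp add: inner_diff_right)
  then show thesis
    using that[of u \<mu>] u by (simp add: v_def inner_diff_right dot_square_norm)
qed

text \<open>Induction on the dimension: split off one unit eigenvector. Self-adjointness keeps its
  orthogonal complement within \<open>T\<close> invariant.\<close>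

lemma self_adjoint_eigenbasis:
  fixes f :: "'a::euclidean_space \<Rightarrow> 'a"
  assumes lin: "linear f" and sa: "\<And>x y. f x \<bullet> y = x \<bullet> f y"
    and "subspace T" "f ` T \<subseteq> T"
  shows "\<exists>B. B \<subseteq> T \<and> finite B \<and> card B = dim T \<and> pairwise orthogonal B \<and>
      (\<forall>b\<in>B. norm b = 1 \<and> (\<exists>\<mu>. f b = \<mu> *\<^sub>R b))"
  using assms(3,4)
proof (induction "dim T" arbitrary: T)
  case 0
  then show ?case by (intro exI[of _ "{}"]) auto
next
  case (Suc k)
  then have "T \<noteq> {0}" by (metis dim_eq_0 nat.distinct(1) subset_refl)
  then obtain u \<mu> where u: "u \<in> T" "norm u = 1" "f u = \<mu> *\<^sub>R u"
    using self_adjoint_eigenvector_exists[OF lin sa] Suc.prems by blast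
  define T' where "T' = {y \<in> T. \<forall>x\<in>span {u}. orthogonal x y}"
  have T'_eq: "T' = {y \<in> T. u \<bullet> y = 0}"
    by (auto simp: T'_def span_singleton orthogonal_def)
  have "dim T' + dim (span {u}) = dim T"
    unfolding T'_def using Suc.prems u
    by (intro dim_subspace_orthogonal_to_vectors) (auto simp: span_minimal)
  moreover have "u \<noteq> 0" using u(2) by auto
  ultimately have dim: "dim T' = k"
    using Suc.hyps(2) by simp
  have "subspace T'"
    using Suc.prems(1) unfolding T'_eq subspace_def by (auto simp: inner_simps)
  moreover have "f ` T' \<subseteq> T'"
  proof (intro subsetI, elim imageE)
    fix x y assume "x = f y" "y \<in> T'"
    then show "x \<in> T'"
      using Suc.prems(2) sa[of u y] u(3) by (auto simp: T'_eq)
  qed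
  ultimately obtain B where B: "B \<subseteq> T'" "finite B" "card B = k" "pairwise orthogonal B"
      "\<forall>b\<in>B. norm b = 1 \<and> (\<exists>\<mu>. f b = \<mu> *\<^sub>R b)"
    using Suc.hyps(1)[OF dim[symmetric]] dim by auto
  have "u \<notin> B" using B(1) u by (auto simp: T'_eq)
  then show ?case
    using B u Suc.hyps(2)
    by (intro exI[of _ "insert u B"])
       (auto simp: T'_eq pairwise_insert orthogonal_def inner_commute)
qed

text \<open>Indexing by the coordinate type itself makes such a family a full basis, and the columns
  of a square orthogonal matrix.\<close>

definition orthonormal :: "('n \<Rightarrow> real^'n) \<Rightarrow> bool" where
  "orthonormal u \<longleftrightarrow> (\<forall>i j. u i \<bullet> u j = (if i = j then 1 else 0))"

lemma symmetric_matrix_eigenbasis: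
  fixes A :: "real^'n^'n"
  assumes "transpose A = A"
  obtains u d where "orthonormal u" "\<And>i. A *v u i = d i *\<^sub>R u i"
proof -
  have sa: "(A *v x) \<bullet> y = x \<bullet> (A *v y)" for x y
    by (metis assms dot_lmul_matrix vector_transpose_matrix)
  obtain B :: "(real^'n) set" where B: "finite B" "card B = CARD('n)" "pairwise orthogonal B"
      "\<forall>b\<in>B. norm b = 1 \<and> (\<exists>\<mu>. A *v b = \<mu> *\<^sub>R b)"
    using self_adjoint_eigenbasis[of "(*v) A" UNIV] sa by auto
  then obtain u where u: "bij_betw u (UNIV :: 'n set) B"
    using finite_same_card_bij[of "UNIV :: 'n set" B] by auto
  then have uB: "u i \<in> B" for i by (auto simp: bij_betw_def)
  then have "\<forall>i. \<exists>\<mu>. A *v u i = \<mu> *\<^sub>R u i"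
    using B(4) by blast
  then obtain d where "\<And>i. A *v u i = d i *\<^sub>R u i"
    by metis
  moreover have "orthonormal u"
    using B(3,4) uB u unfolding orthonormal_def pairwise_def orthogonal_def bij_betw_def inj_on_def
    by (auto simp: dot_square_norm) (metis rangeI)
  ultimately show thesis using that by blast
qed

section \<open>Coordinates and determinants in an orthonormal eigenbasis\<close>

lemma orthonormal_matrix:
  assumes "orthonormal u"
  shows "transpose (\<chi> r c. u c $ r) ** (\<chi> r c. u c $ r) = mat 1"
    and "(\<chi> r c. u c $ r) ** transpose (\<chi> r c. u c $ r) = mat 1"
proof -
  show "transpose (\<chi> r c. u c $ r) ** (\<chi> r c. u c $ r) = mat 1"
    using assms by (simp add: orthonormal_def matrix_matrix_mult_def transpose_def mat_def inner_vec_def vec_eq_iff)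
  then show "(\<chi> r c. u c $ r) ** transpose (\<chi> r c. u c $ r) = mat 1"
    by (simp add: matrix_left_right_inverse)
qed

lemma orthonormal_expand:
  assumes "orthonormal u"
  shows "(\<Sum>i\<in>UNIV. (u i \<bullet> x) *\<^sub>R u i) = x"
proof -
  have "(\<chi> r c. u c $ r) *v (transpose (\<chi> r c. u c $ r) *v x) = x"
    using orthonormal_matrix(2)[OF assms] by (simp only: matrix_vector_mul_assoc matrix_vector_mul_lid)
  also have "transpose (\<chi> r c. u c $ r) *v x = (\<chi> i. u i \<bullet> x)"
    by (simp only: matrix_vector_mult_def transpose_def inner_vec_def vec_eq_iff) simp
  finally show ?thesis
    by (simp add: matrix_vector_mult_def vec_eq_iff mult.commute)
qed

lemma orthonormal_inner:
  assumes "orthonormal u"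
  shows "x \<bullet> y = (\<Sum>i\<in>UNIV. (u i \<bullet> x) * (u i \<bullet> y))"
  by (subst (1) orthonormal_expand[OF assms, of x, symmetric])
     (simp add: inner_sum_left)

lemma orthonormalD: "orthonormal u \<Longrightarrow> u i \<bullet> u j = (if i = j then 1 else 0)"
  by (simp add: orthonormal_def)

lemma orthonormal_coordinate:
  "orthonormal u \<Longrightarrow> u i \<bullet> (\<Sum>j\<in>UNIV. c j *\<^sub>R u j) = c i"
  by (simp add: inner_sum_right orthonormalD if_distrib cong: if_cong)

lemma orthonormal_combination_inner:
  "orthonormal u \<Longrightarrow> (\<Sum>i\<in>UNIV. c i *\<^sub>R u i) \<bullet> (\<Sum>i\<in>UNIV. e i *\<^sub>R u i) = (\<Sum>i\<in>UNIV. c i * e i)"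
  by (simp add: inner_sum_left orthonormal_coordinate)

lemma eigenbasis_mult:
  assumes "orthonormal u" "\<And>i. A *v u i = d i *\<^sub>R u i"
  shows "A *v x = (\<Sum>i\<in>UNIV. (d i * (u i \<bullet> x)) *\<^sub>R u i)"
  by (subst (1) orthonormal_expand[OF assms(1), of x, symmetric])
     (simp add: linear_sum[OF matrix_vector_mul_linear] linear_cmul[OF matrix_vector_mul_linear] assms mult.commute)

text \<open>The matrix \<open>P\<close> of eigenvectors diagonalises \<open>A + mat t\<close>, and
  its nonzero determinant cancels. The shift covers the plain determinant (\<open>t = 0\<close>),
  the characteristic polynomial (negative argument) and the added noise variance.\<close>

lemma det_shift_eigenbasis:
  fixes A :: "real^'n^'n"
  assumes "orthonormal u" "\<And>i. A *v u i = d i *\<^sub>R u i"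
  shows "det (A + mat t) = (\<Prod>i\<in>UNIV. d i + t)"
proof -
  define P :: "real^'n^'n" where "P = (\<chi> r c. u c $ r)"
  define D :: "real^'n^'n" where "D = (\<chi> i j. if i = j then d i + t else 0)"
  have add: "((A + mat t) ** P) $ r $ c = (A ** P) $ r $ c + (mat t ** P) $ r $ c" for r c
    by (simp add: matrix_matrix_mult_def sum.distrib algebra_simps)
  have "(A ** P) $ r $ c = (A *v u c) $ r" for r c
    by (simp add: matrix_matrix_mult_def matrix_vector_mult_def P_def)
  moreover have "(P ** D) $ r $ c = (d c + t) * u c $ r" for r c
    by (simp add: matrix_matrix_mult_def P_def D_def if_distrib cong: if_cong)
  moreover have "(mat t ** P) $ r $ c = t * u c $ r" for r c
    by (simp add: matrix_matrix_mult_def P_def mat_def if_distrib if_distribR cong: if_cong)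
  ultimately have "(A + mat t) ** P = P ** D"
    by (simp add: vec_eq_iff add assms algebra_simps)
  moreover have "det P \<noteq> 0"
    using arg_cong[OF orthonormal_matrix(2)[OF assms(1)], of det]
    by (auto simp: det_mul P_def[symmetric])
  ultimately have "det (A + mat t) = det D"
    by (metis det_mul mult.commute mult_left_cancel)
  also have "det D = (\<Prod>i\<in>UNIV. d i + t)"
    by (subst det_diagonal) (auto simp: D_def)
  finally show ?thesis .
qed

section \<open>Positive definite matrices\<close>

lemma pos_def_eigenvalues_pos:
  assumes "pos_def_matrix A" "orthonormal u" "\<And>i. A *v u i = d i *\<^sub>R u i"
  shows "d i > 0"
proof -
  have "u i \<bullet> u i = 1" using assms(2) by (simp add: orthonormal_def)
  moreover from this have "u i \<noteq> 0" by auto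
  ultimately show ?thesis
    using assms(1,3) unfolding pos_def_matrix_def by fastforce
qed

lemma pos_def_det_pos: "pos_def_matrix A \<Longrightarrow> det A > 0"
proof -
  assume A: "pos_def_matrix A"
  then obtain u d where u: "orthonormal u" "\<And>i. A *v u i = d i *\<^sub>R u i"
    using symmetric_matrix_eigenbasis[of A] by (auto simp: pos_def_matrix_def)
  then show ?thesis
    using det_shift_eigenbasis[OF u, of 0] pos_def_eigenvalues_pos[OF A u] by (simp add: prod_pos mat_0)
qed

lemma pos_def_inverse:
  assumes "pos_def_matrix A"
  shows "A *v (matrix_inv A *v x) = x" "matrix_inv A *v (A *v x) = x"
proof -
  have "invertible A"
    using pos_def_det_pos[OF assms] by (simp add: invertible_det_nz)
  then have "A ** matrix_inv A = mat 1 \<and> matrix_inv A ** A = mat 1"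
    unfolding invertible_def matrix_inv_def by (rule someI_ex)
  then show "A *v (matrix_inv A *v x) = x" "matrix_inv A *v (A *v x) = x"
    by (simp_all only: matrix_vector_mul_assoc matrix_vector_mul_lid)
qed

lemma pos_def_self_adjoint: "pos_def_matrix A \<Longrightarrow> (A *v x) \<bullet> y = x \<bullet> (A *v y)"
  by (metis pos_def_matrix_def dot_lmul_matrix vector_transpose_matrix)

section \<open>Gaussian integrals\<close>

lemma nn_integral_lborel_translate:
  fixes c :: "'a::euclidean_space"
  assumes [measurable]: "h \<in> borel_measurable borel"
  shows "(\<integral>\<^sup>+x. h (c + x) \<partial>lborel) = (\<integral>\<^sup>+x. h x \<partial>lborel)"
  by (subst (2) lborel_distr_plus[of c, symmetric]) (simp add: nn_integral_distr)

text \<open>The linear change of variables of the library needs a well-ordered index type. Instead, as in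
  the uniqueness proof for Haar measure, evaluate the double integral of \<open>h (y + f x) g y\<close> in both
  orders, where \<open>g\<close> is the indicator of the unit ball, which \<open>f\<close> preserves.\<close>
lemma nn_integral_lborel_isometry:
  fixes f :: "'a::euclidean_space \<Rightarrow> 'a"
  assumes lin: "linear f" and iso: "\<And>x. norm (f x) = norm x"
    and [measurable]: "h \<in> borel_measurable borel"
  shows "(\<integral>\<^sup>+x. h (f x) \<partial>lborel) = (\<integral>\<^sup>+x. h x \<partial>lborel)"
proof -
  define g :: "'a \<Rightarrow> ennreal" where "g = indicator (ball 0 1)"
  define a where "a = (\<integral>\<^sup>+x. g x \<partial>(lborel :: 'a measure))"
  have [measurable]: "g \<in> borel_measurable borel"
    unfolding g_def by (intro borel_measurable_indicator) simp
  have [measurable]: "f \<in> borel_measurable borel"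
    using lin by (intro borel_measurable_continuous_onI linear_continuous_on) (simp add: linear_linear)
  \<comment> \<open>Both are needed to cancel the factor \<open>a\<close> at the end.\<close>
  have a: "a \<noteq> 0" "a \<noteq> \<top>"
    using emeasure_lborel_ball_finite[of "0::'a" 1] content_ball_pos[of 1 "0::'a"]
    by (auto simp: a_def g_def top_unique measure_def less_top)
  have "inj f"
    using iso by (intro linear_injective_0[OF lin, THEN iffD2]) (metis norm_eq_zero)
  then have "surj f"
    using lin linear_injective_imp_surjective by blast
  then obtain w where w: "\<And>y. f (w y) = y" by (metis surjD)
  \<comment> \<open>As \<open>f\<close> is onto, \<open>y = f (w y)\<close>; the isometry then turns
    the condition on \<open>y - f x\<close> into membership of \<open>x\<close> in a unit ball
    around \<open>w y\<close>.\<close>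
  have shift: "(\<integral>\<^sup>+x. g (y - f x) \<partial>lborel) = a" for y
  proof -
    have "g (y - f x) = g (- w y + x)" for x
    proof -
      have "y - f x = f (w y - x)" by (simp add: linear_diff[OF lin] w)
      then have "norm (y - f x) = norm (- w y + x)" by (simp add: iso norm_minus_commute)
      then show ?thesis by (simp add: g_def indicator_def)
    qed
    then show ?thesis
      using nn_integral_lborel_translate[of g "- w y"] by (simp add: a_def)
  qed
  have "(\<integral>\<^sup>+x. h (f x) \<partial>lborel) * a = (\<integral>\<^sup>+y. (\<integral>\<^sup>+x. h (f x) \<partial>lborel) * g y \<partial>lborel)"
    by (simp add: a_def nn_integral_cmult)
  also have "\<dots> = (\<integral>\<^sup>+y. (\<integral>\<^sup>+x. h (y + f x) * g y \<partial>lborel) \<partial>lborel)"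
  proof (rule nn_integral_cong)
    fix y
    have "(\<integral>\<^sup>+x. h (f x) \<partial>lborel) = (\<integral>\<^sup>+x. h (f (w y + x)) \<partial>lborel)"
      by (intro nn_integral_lborel_translate[symmetric]) measurable
    then show "(\<integral>\<^sup>+x. h (f x) \<partial>lborel) * g y = (\<integral>\<^sup>+x. h (y + f x) * g y \<partial>lborel)"
      by (simp add: linear_add[OF lin] w nn_integral_multc)
  qed
  also have "\<dots> = (\<integral>\<^sup>+x. (\<integral>\<^sup>+y. h (y + f x) * g y \<partial>lborel) \<partial>lborel)"
    by (rule lborel_pair.Fubini') measurable
  also have "\<dots> = (\<integral>\<^sup>+x. (\<integral>\<^sup>+y. h y * g (y - f x) \<partial>lborel) \<partial>lborel)"
  proof (rule nn_integral_cong)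
    fix x
    show "(\<integral>\<^sup>+y. h (y + f x) * g y \<partial>lborel) = (\<integral>\<^sup>+y. h y * g (y - f x) \<partial>lborel)"
      using nn_integral_lborel_translate[of "\<lambda>y. h y * g (y - f x)" "f x"] by (simp add: add.commute)
  qed
  also have "\<dots> = (\<integral>\<^sup>+y. (\<integral>\<^sup>+x. h y * g (y - f x) \<partial>lborel) \<partial>lborel)"
    by (rule lborel_pair.Fubini') measurable
  also have "\<dots> = (\<integral>\<^sup>+y. h y \<partial>lborel) * a"
    by (simp add: nn_integral_cmult shift nn_integral_multc)
  finally show ?thesis
    using a by (metis ennreal_mult_divide_eq)
qed

lemma nn_integral_orthonormal:
  fixes u :: "'n \<Rightarrow> real^'n"
  assumes u: "orthonormal u" and [measurable]: "h \<in> borel_measurable borel"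
  shows "(\<integral>\<^sup>+x. h x \<partial>lborel) = (\<integral>\<^sup>+x. h (\<Sum>i\<in>UNIV. x $ i *\<^sub>R u i) \<partial>lborel)"
proof (rule nn_integral_lborel_isometry[symmetric])
  show "linear (\<lambda>x::real^'n. \<Sum>i\<in>UNIV. x $ i *\<^sub>R u i)"
    by (intro linearI) (simp_all add: scaleR_add_left sum.distrib scaleR_sum_right)
  show "norm (\<Sum>i\<in>UNIV. x $ i *\<^sub>R u i) = norm x" for x :: "real^'n"
    unfolding norm_eq orthonormal_combination_inner[OF u] by (simp add: inner_vec_def)
qed fact

lemma prod_Basis_vec: "(\<Prod>b\<in>Basis. F b) = (\<Prod>i\<in>UNIV. F (axis i 1 :: real^'n))"
proof -
  have "Basis = range (\<lambda>i. axis i 1 :: real^'n)"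
    by (auto simp: Basis_vec_def)
  moreover have "inj (\<lambda>i. axis i 1 :: real^'n)"
    by (auto simp: inj_def axis_eq_axis)
  ultimately show ?thesis by (metis (no_types, lifting) prod.reindex_cong)
qed

lemma nn_integral_lborel_vec_prod:
  fixes f :: "'n::finite \<Rightarrow> real \<Rightarrow> ennreal"
  assumes "\<And>i. f i \<in> borel_measurable borel"
  shows "(\<integral>\<^sup>+x. (\<Prod>i\<in>UNIV. f i (x $ i)) \<partial>(lborel :: (real^'n) measure)) = (\<Prod>i\<in>UNIV. \<integral>\<^sup>+t. f i t \<partial>lborel)"
proof -
  \<comment> \<open>The product formula for \<open>lborel\<close> is indexed by
    \<open>Basis\<close>, so the factors are relabelled; only the values of \<open>F\<close> at the
    vectors \<open>axis i 1\<close> matter.\<close>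
  define F :: "(real^'n) \<Rightarrow> real \<Rightarrow> ennreal" where "F b = f (SOME i. b = axis i 1)" for b
  have F: "F (axis i 1) = f i" for i
    by (simp add: F_def axis_eq_axis)
  have "(\<integral>\<^sup>+x. (\<Prod>b\<in>Basis. F b (x \<bullet> b)) \<partial>(lborel :: (real^'n) measure)) = (\<Prod>b\<in>Basis. \<integral>\<^sup>+t. F b t \<partial>lborel)"
    by (rule nn_integral_lborel_prod) (simp_all add: F_def assms)
  then show ?thesis
    by (simp add: prod_Basis_vec F inner_axis)
qed

section \<open>Gaussian densities: factorisation, total mass and expected quadratic form\<close>

lemma measurable_matrix_vector_mult [measurable (raw)]:
  fixes A :: "real^'n^'m"
  assumes "f \<in> M \<rightarrow>\<^sub>M borel"
  shows "(\<lambda>x. A *v f x) \<in> M \<rightarrow>\<^sub>M borel"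
proof -
  have "(*v) A \<in> borel \<rightarrow>\<^sub>M borel"
    by (intro borel_measurable_continuous_onI linear_continuous_on matrix_vector_mul_bounded_linear)
  from measurable_compose[OF assms this] show ?thesis .
qed

lemma measurable_gauss_density [measurable (raw)]:
  assumes [measurable]: "f \<in> M \<rightarrow>\<^sub>M borel" "g \<in> M \<rightarrow>\<^sub>M borel"
  shows "(\<lambda>x. gauss_density A (f x) (g x)) \<in> borel_measurable M"
  unfolding gauss_density_def by measurable

lemma gauss_density_pos: "pos_def_matrix A \<Longrightarrow> gauss_density A m x > 0"
  using pos_def_det_pos[of A] by (simp add: gauss_density_def)

lemma gauss_density_translate: "gauss_density A m x = gauss_density A 0 (x - m)"
  by (simp add: gauss_density_def)

lemma eigenbasis_inverse:
  assumes A: "pos_def_matrix A" and u: "orthonormal u" "\<And>i. A *v u i = d i *\<^sub>R u i"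
  shows "matrix_inv A *v u i = (1 / d i) *\<^sub>R u i"
proof -
  have "u i = A *v ((1 / d i) *\<^sub>R u i)"
    using pos_def_eigenvalues_pos[OF A u, of i] by (simp add: matrix_vector_mult_scaleR u(2))
  then show ?thesis using pos_def_inverse(2)[OF A] by metis
qed

lemma inverse_quadratic_eigenbasis:
  assumes A: "pos_def_matrix A" and u: "orthonormal u" "\<And>i. A *v u i = d i *\<^sub>R u i"
  shows "(\<Sum>i\<in>UNIV. x $ i *\<^sub>R u i) \<bullet> (matrix_inv A *v (\<Sum>i\<in>UNIV. x $ i *\<^sub>R u i)) = (\<Sum>i\<in>UNIV. (x $ i)\<^sup>2 / d i)"
  unfolding eigenbasis_mult[OF u(1) eigenbasis_inverse[OF A u]] orthonormal_coordinate[OF u(1)]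
    orthonormal_combination_inner[OF u(1)] by (simp add: power2_eq_square)

lemma sqrt_prod: "sqrt (prod f S) = (\<Prod>x\<in>S. sqrt (f x))"
  by (induction S rule: infinite_finite_induct) (simp_all add: real_sqrt_mult)

lemma gauss_density_eigenbasis:
  fixes A :: "real^'n^'n"
  assumes A: "pos_def_matrix A" and u: "orthonormal u" "\<And>i. A *v u i = d i *\<^sub>R u i"
  shows "gauss_density A 0 (\<Sum>i\<in>UNIV. x $ i *\<^sub>R u i) = (\<Prod>i\<in>UNIV. normal_density 0 (sqrt (d i)) (x $ i))"
proof -
  have d: "d i > 0" for i by (rule pos_def_eigenvalues_pos[OF A u])
  have "det A = (\<Prod>i\<in>UNIV. d i)"
    using det_shift_eigenbasis[OF u, of 0] by (simp add: mat_0)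
  then have "sqrt ((2 * pi) ^ CARD('n) * det A) = (\<Prod>i\<in>UNIV. sqrt (2 * pi * d i))"
    using prod.distrib[of "\<lambda>_. 2 * pi" d UNIV] by (simp add: real_sqrt_mult prod.distrib sqrt_prod real_sqrt_power power_mult_distrib)
  moreover have "- (1 / 2) * (\<Sum>i\<in>UNIV. (x $ i)\<^sup>2 / d i) = (\<Sum>i\<in>UNIV. - ((x $ i)\<^sup>2 / (2 * d i)))"
    by (simp add: sum_distrib_left sum_negf)
  ultimately show ?thesis
    using d
    by (simp add: gauss_density_def inverse_quadratic_eigenbasis[OF A u] normal_density_def
        prod_dividef less_imp_le flip: exp_sum)
qed

lemma nn_integral_normal_density:
  assumes "\<sigma> > 0"
  shows "(\<integral>\<^sup>+x. normal_density 0 \<sigma> x \<partial>lborel) = 1"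
    and "(\<integral>\<^sup>+x. normal_density 0 \<sigma> x * (x\<^sup>2 / \<sigma>\<^sup>2) \<partial>lborel) = 1"
proof -
  show "(\<integral>\<^sup>+x. normal_density 0 \<sigma> x \<partial>lborel) = 1"
    using assms by (subst nn_integral_eq_integral) auto
  have "has_bochner_integral lborel (\<lambda>x. normal_density 0 \<sigma> x * x ^ 2) (\<sigma>\<^sup>2)"
    using normal_moment_even[of \<sigma> 0 1] assms by (simp add: fact_numeral)
  from has_bochner_integral_mult_right[OF this, of "1 / \<sigma>\<^sup>2"] assms
  have "has_bochner_integral lborel (\<lambda>x. normal_density 0 \<sigma> x * (x\<^sup>2 / \<sigma>\<^sup>2)) 1"
    by (simp add: mult_ac)
  then show "(\<integral>\<^sup>+x. normal_density 0 \<sigma> x * (x\<^sup>2 / \<sigma>\<^sup>2) \<partial>lborel) = 1"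
    using has_bochner_integral_nn_integral
    by (subst nn_integral_eq_integral) (auto simp: has_bochner_integral_iff)
qed

text \<open>In eigenbasis coordinates the density is a product of centred normals with variances
  \<open>d i\<close>, and the quadratic form is the sum of the squared coordinates divided by these
  variances. Each summand has expectation 1, so the total is the dimension.\<close>

lemma nn_integral_gauss_density_0:
  fixes A :: "real^'n^'n"
  assumes A: "pos_def_matrix A"
  shows "(\<integral>\<^sup>+x. gauss_density A 0 x \<partial>lborel) = 1"
    and "(\<integral>\<^sup>+x. gauss_density A 0 x * (x \<bullet> (matrix_inv A *v x)) \<partial>lborel) = real CARD('n)"
proof -
  obtain u d where u: "orthonormal u" "\<And>i. A *v u i = d i *\<^sub>R u i"
    using symmetric_matrix_eigenbasis[of A] A by (auto simp: pos_def_matrix_def)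
  have d: "d i > 0" for i by (rule pos_def_eigenvalues_pos[OF A u])
  let ?n = "\<lambda>i. normal_density 0 (sqrt (d i))"
  have "(\<integral>\<^sup>+x. gauss_density A 0 x \<partial>lborel) = (\<integral>\<^sup>+x. (\<Prod>i\<in>UNIV. ennreal (?n i (x $ i))) \<partial>lborel)"
    by (subst nn_integral_orthonormal[OF u(1)]) (simp_all add: gauss_density_eigenbasis[OF A u] prod_ennreal)
  also have "\<dots> = 1"
    using d by (subst nn_integral_lborel_vec_prod[where f="\<lambda>i t. ennreal (?n i t)"])
      (simp_all add: nn_integral_normal_density)
  finally show "(\<integral>\<^sup>+x. gauss_density A 0 x \<partial>lborel) = 1" .
  \<comment> \<open>The \<open>k\<close>-th summand of the quadratic form times the density is again
    a product over coordinates: only factor \<open>k\<close> carries the extra square.\<close>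
  define f where "f k i t = ennreal (?n i t * (if i = k then t\<^sup>2 / d i else 1))" for k i t
  have f: "(\<Prod>i\<in>UNIV. f k i (x $ i)) = ennreal ((\<Prod>i\<in>UNIV. ?n i (x $ i)) * ((x $ k)\<^sup>2 / d k))" for k x
    using d by (simp add: f_def prod_ennreal less_imp_le prod.distrib)
  have "(\<integral>\<^sup>+x. gauss_density A 0 x * (x \<bullet> (matrix_inv A *v x)) \<partial>lborel) =
      (\<integral>\<^sup>+x. (\<Sum>k\<in>UNIV. \<Prod>i\<in>UNIV. f k i (x $ i)) \<partial>lborel)"
    using d by (subst nn_integral_orthonormal[OF u(1)])
      (simp_all add: gauss_density_eigenbasis[OF A u] inverse_quadratic_eigenbasis[OF A u] f
         sum_distrib_left prod_nonneg less_imp_le)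
  also have "\<dots> = (\<Sum>k\<in>UNIV. \<integral>\<^sup>+x. (\<Prod>i\<in>UNIV. f k i (x $ i)) \<partial>(lborel :: (real^'n) measure))"
    by (intro nn_integral_sum) (simp add: f_def)
  also have "\<dots> = (\<Sum>k\<in>(UNIV::'n set). 1)"
  proof (intro sum.cong refl)
    fix k
    have "(\<integral>\<^sup>+t. f k i t \<partial>lborel) = 1" for i
      using nn_integral_normal_density[of "sqrt (d i)"] d[of i] by (cases "i = k") (simp_all add: f_def)
    moreover have "f k i \<in> borel_measurable borel" for i
      unfolding f_def by measurable
    ultimately show "(\<integral>\<^sup>+x. (\<Prod>i\<in>UNIV. f k i (x $ i)) \<partial>(lborel :: (real^'n) measure)) = 1"
      by (subst nn_integral_lborel_vec_prod) simp_all
  qed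
  finally show "(\<integral>\<^sup>+x. gauss_density A 0 x * (x \<bullet> (matrix_inv A *v x)) \<partial>lborel) = real CARD('n)"
    by (simp add: ennreal_of_nat_eq_real_of_nat)
qed

lemma nn_integral_gauss_density:
  fixes A :: "real^'n^'n"
  assumes A: "pos_def_matrix A"
  shows "(\<integral>\<^sup>+x. gauss_density A m x \<partial>lborel) = 1"
    and "(\<integral>\<^sup>+x. gauss_density A m x * ((x - m) \<bullet> (matrix_inv A *v (x - m))) \<partial>lborel) = real CARD('n)"
proof -
  have eq: "gauss_density A m x = gauss_density A 0 (- m + x)" "x - m = - m + x" for x
    by (simp_all add: gauss_density_translate[of A m])
  show "(\<integral>\<^sup>+x. gauss_density A m x \<partial>lborel) = 1"
    unfolding eq(1) nn_integral_gauss_density_0(1)[OF A, symmetric]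
    by (rule nn_integral_lborel_translate) measurable
  show "(\<integral>\<^sup>+x. gauss_density A m x * ((x - m) \<bullet> (matrix_inv A *v (x - m))) \<partial>lborel) = real CARD('n)"
    unfolding eq nn_integral_gauss_density_0(2)[OF A, symmetric]
    by (rule nn_integral_lborel_translate) measurable
qed

section \<open>Mutual information of the Gaussian channel\<close>

lemma mat_mult_vec: "mat s *v x = s *\<^sub>R (x :: real^'n)"
  by (simp add: matrix_vector_mult_def mat_def vec_eq_iff if_distrib if_distribR cong: if_cong)

lemma pos_def_mat: "s > 0 \<Longrightarrow> pos_def_matrix (mat s :: real^'n^'n)"
  by (simp add: pos_def_matrix_def mat_mult_vec)

lemma inverse_mat_mult_vec: "s > 0 \<Longrightarrow> matrix_inv (mat s) *v x = (1 / s) *\<^sub>R (x :: real^'n)"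
  using arg_cong[OF pos_def_inverse(1)[OF pos_def_mat, of s x], of "scaleR (1 / s)"]
  by (simp add: mat_mult_vec)

lemma det_mat: "det (mat s :: real^'n^'n) = s ^ CARD('n)"
  by (subst det_diagonal) (simp_all add: mat_def)

text \<open>With \<open>y = matrix_inv A *v x\<close> the form becomes the one of \<open>A\<close>
  at \<open>y\<close>.\<close>

lemma pos_def_inverse_quadratic_nonneg:
  assumes "pos_def_matrix A"
  shows "x \<bullet> (matrix_inv A *v x) \<ge> 0"
  using assms pos_def_inverse(1)[OF assms, of x]
  by (cases "matrix_inv A *v x = 0") (auto simp: pos_def_matrix_def inner_commute dest!: spec[of _ "matrix_inv A *v x"])

definition output_cov :: "real^'n^'n \<Rightarrow> real \<Rightarrow> real^'n^'m \<Rightarrow> real^'m^'m" where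
  "output_cov Sx s W = W ** Sx ** transpose W + mat s"

lemma output_cov_mult_vec:
  "output_cov Sx s W *v y = W *v (Sx *v (y v* W)) + s *\<^sub>R y"
  by (simp add: output_cov_def matrix_vector_mult_add_rdistrib mat_mult_vec flip: matrix_vector_mul_assoc)

lemma pos_def_output_cov:
  fixes W :: "real^'n^'m"
  assumes Sx: "pos_def_matrix Sx" and s: "s > 0"
  shows "pos_def_matrix (output_cov Sx s W)"
  unfolding pos_def_matrix_def
proof (intro conjI allI impI)
  have "transpose (A + B) = transpose A + transpose B" for A B :: "real^'m^'m"
    by (simp add: transpose_def vec_eq_iff)
  then show "transpose (output_cov Sx s W) = output_cov Sx s W"
    using Sx by (simp add: output_cov_def pos_def_matrix_def matrix_transpose_mul matrix_mul_assoc)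
  fix x :: "real^'m" assume "x \<noteq> 0"
  moreover have "0 \<le> (x v* W) \<bullet> (Sx *v (x v* W))"
    using Sx unfolding pos_def_matrix_def by (cases "x v* W = 0") auto
  ultimately show "x \<bullet> (output_cov Sx s W *v x) > 0"
    using s by (simp add: output_cov_mult_vec inner_add_right dot_lmul_matrix add_nonneg_pos)
qed

text \<open>\<open>x0 z\<close> is the conditional mean of the input given output \<open>z\<close>
  at zero offset. Expanding around it, the two quadratic forms contribute opposite cross terms in
  \<open>h\<close>, so the exponent separates into a part in \<open>z\<close> and a part in
  \<open>h\<close>.\<close>

lemma complete_the_square:
  fixes W :: "real^'n^'m"
  assumes Sx: "pos_def_matrix Sx" and s: "s > 0"
  defines "S \<equiv> output_cov Sx s W"
  defines "x0 \<equiv> \<lambda>z. Sx *v ((matrix_inv S *v z) v* W)"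
  shows "(x0 z + h) \<bullet> (matrix_inv Sx *v (x0 z + h)) + (z - W *v (x0 z + h)) \<bullet> (matrix_inv (mat s) *v (z - W *v (x0 z + h)))
    = z \<bullet> (matrix_inv S *v z) + (h \<bullet> (matrix_inv Sx *v h) + (W *v h) \<bullet> (W *v h) / s)"
proof -
  define y where "y = matrix_inv S *v z"
  have S: "pos_def_matrix S" unfolding S_def by (rule pos_def_output_cov[OF Sx s])
  have x0: "x0 z = Sx *v (y v* W)" by (simp add: x0_def y_def)
  \<comment> \<open>This is \<open>S *v y = z\<close> written out; it identifies the residual at the
    conditional mean as \<open>s *\<^sub>R y\<close>.\<close>
  have z: "z = W *v x0 z + s *\<^sub>R y"
    using pos_def_inverse(1)[OF S, of z, folded y_def] unfolding x0 S_def output_cov_mult_vec by simp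
  have inv: "matrix_inv Sx *v (x0 z + h) = y v* W + matrix_inv Sx *v h"
    by (simp add: matrix_vector_right_distrib x0 pos_def_inverse[OF Sx])
  have "x0 z \<bullet> (matrix_inv Sx *v h) = y \<bullet> (W *v h)"
    unfolding x0 by (simp add: pos_def_self_adjoint[OF Sx] pos_def_inverse[OF Sx] dot_lmul_matrix)
  moreover have "x0 z \<bullet> (y v* W) = y \<bullet> (W *v x0 z)" "h \<bullet> (y v* W) = y \<bullet> (W *v h)"
    by (simp_all add: inner_commute[of _ "y v* W"] dot_lmul_matrix)
  ultimately have "(x0 z + h) \<bullet> (matrix_inv Sx *v (x0 z + h)) =
      y \<bullet> (W *v x0 z) + 2 * (y \<bullet> (W *v h)) + h \<bullet> (matrix_inv Sx *v h)"
    unfolding inv by (simp add: inner_add_left inner_add_right)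
  moreover have r: "z - W *v (x0 z + h) = s *\<^sub>R y - W *v h"
    by (subst z) (simp add: matrix_vector_right_distrib)
  have "(z - W *v (x0 z + h)) \<bullet> (matrix_inv (mat s) *v (z - W *v (x0 z + h))) =
      s * (y \<bullet> y) - 2 * (y \<bullet> (W *v h)) + (W *v h) \<bullet> (W *v h) / s"
    unfolding r using s
    by (simp add: inverse_mat_mult_vec[OF s] inner_diff_left inner_diff_right inner_commute[of "W *v h" y] field_simps)
  moreover have "z \<bullet> y = y \<bullet> (W *v x0 z) + s * (y \<bullet> y)"
    by (subst (1) z) (simp add: inner_add_left inner_add_right inner_commute)
  ultimately show ?thesis by (simp add: y_def)
qed

text \<open>In the shifted variable \<open>h\<close> of \<open>complete_the_square\<close> the joint density factors, so the marginal is a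
  constant multiple of the claimed density, and the constant is 1 because both integrate to 1.\<close>
lemma marginal_output_density:
  fixes W :: "real^'n^'m"
  assumes Sx: "pos_def_matrix Sx" and s: "s > 0"
  shows "(\<integral>\<^sup>+x. gauss_density Sx 0 x * gauss_density (mat s) (W *v x + b) z \<partial>lborel) = gauss_density (output_cov Sx s W) b z"
proof -
  define S where "S = output_cov Sx s W"
  define x0 where "x0 z = Sx *v ((matrix_inv S *v z) v* W)" for z
  define N where "N A = sqrt ((2 * pi) ^ CARD('m) * det A)" for A :: "real^'m^'m"
  \<comment> \<open>The factor depending on \<open>h\<close>, together with all normalising
    constants. \<open>N S\<close> is in the numerator because \<open>gauss_density S\<close> already
    divides by it.\<close>
  define k where "k h = exp (- (1/2) * (h \<bullet> (matrix_inv Sx *v h) + (W *v h) \<bullet> (W *v h) / s)) * N S /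
     (sqrt ((2 * pi) ^ CARD('n) * det Sx) * N (mat s))" for h
  define c where "c = (\<integral>\<^sup>+h. ennreal (k h) \<partial>lborel)"
  have S: "pos_def_matrix S" unfolding S_def by (rule pos_def_output_cov[OF Sx s])
  note m = pos_def_mat[OF s, where 'n='m]
  have N: "N A > 0" if "pos_def_matrix A" for A
    using pos_def_det_pos[OF that] by (simp add: N_def)
  have k: "k h \<ge> 0" for h
    using N[OF S] N[OF m] pos_def_det_pos[OF Sx] by (simp add: k_def)
  have [measurable]: "k \<in> borel_measurable borel"
    unfolding k_def by measurable
  have factor: "gauss_density Sx 0 (x0 (z - b) + h) * gauss_density (mat s) (W *v (x0 (z - b) + h) + b) z =
      gauss_density S b z * k h" for z h
  proof -
    have *: "z - (W *v (x0 (z - b) + h) + b) = z - b - W *v (x0 (z - b) + h)" by simp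
    show ?thesis
      using complete_the_square[OF Sx s, of W "z - b" h, folded S_def, folded x0_def]
      unfolding gauss_density_def k_def N_def[symmetric] * diff_0_right
      using N[OF S] by (simp add: divide_simps flip: exp_add distrib_left)
  qed
  have marg: "(\<integral>\<^sup>+x. gauss_density Sx 0 x * gauss_density (mat s) (W *v x + b) z \<partial>lborel) =
      gauss_density S b z * c" for z
  proof -
    have "(\<integral>\<^sup>+x. gauss_density Sx 0 x * gauss_density (mat s) (W *v x + b) z \<partial>lborel) =
       (\<integral>\<^sup>+h. gauss_density Sx 0 (x0 (z - b) + h) * gauss_density (mat s) (W *v (x0 (z - b) + h) + b) z \<partial>lborel)"
      by (rule nn_integral_lborel_translate[symmetric]) measurable
    also have "\<dots> = gauss_density S b z * c"
      unfolding factor using gauss_density_pos[OF S] k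
      by (simp add: c_def ennreal_mult less_imp_le nn_integral_cmult)
    finally show ?thesis .
  qed
  \<comment> \<open>No determinant identity is needed to evaluate \<open>c\<close>: integrating the
    marginal over \<open>z\<close> returns \<open>c\<close>, while the other order of integration
    returns 1.\<close>
  have "c = (\<integral>\<^sup>+z. gauss_density S b z * c \<partial>lborel)"
    by (simp add: nn_integral_multc nn_integral_gauss_density[OF S])
  also have "\<dots> = (\<integral>\<^sup>+z. (\<integral>\<^sup>+x. gauss_density Sx 0 x * gauss_density (mat s) (W *v x + b) z \<partial>lborel) \<partial>lborel)"
    by (simp add: marg)
  also have "\<dots> = (\<integral>\<^sup>+x. (\<integral>\<^sup>+z. gauss_density Sx 0 x * gauss_density (mat s) (W *v x + b) z \<partial>lborel) \<partial>lborel)"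
    by (rule lborel_pair.Fubini') measurable
  also have "\<dots> = (\<integral>\<^sup>+x. gauss_density Sx 0 x \<partial>lborel)"
    using gauss_density_pos[OF Sx] gauss_density_pos[OF m]
    by (simp add: ennreal_mult less_imp_le nn_integral_cmult nn_integral_gauss_density[OF m])
  also have "\<dots> = 1"
    by (rule nn_integral_gauss_density[OF Sx])
  finally show ?thesis by (simp add: marg S_def)
qed

text \<open>The input density cancels in the likelihood ratio, leaving the conditional over the
  marginal output density. Its logarithm is a constant plus half of \<open>q2 - q1\<close>, and the
  two expectations cancel.\<close>

lemma MI_Wb_eq:
  fixes W :: "real^'n^'m"
  assumes Sx: "pos_def_matrix Sx" and s: "s > 0"
  shows "MI_Wb Sx s W b = 1/2 * ln (det (output_cov Sx s W) / s ^ CARD('m))"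
proof -
  define S where "S = output_cov Sx s W"
  define F where "F p = gauss_density Sx 0 (fst p) * gauss_density (mat s) (W *v fst p + b) (snd p)" for p
  define q1 where "q1 p = (snd p - (W *v fst p + b)) \<bullet> (matrix_inv (mat s) *v (snd p - (W *v fst p + b)))" for p
  define r where "r z = (z - b) \<bullet> (matrix_inv S *v (z - b))" for z
  define q2 where "q2 p = r (snd p)" for p :: "(real^'n) \<times> (real^'m)"
  let ?M = "joint_law Sx s W b" and ?L = "lborel \<Otimes>\<^sub>M lborel :: ((real^'n) \<times> (real^'m)) measure"
  have S: "pos_def_matrix S" unfolding S_def by (rule pos_def_output_cov[OF Sx s])
  note m = pos_def_mat[OF s, where 'n='m]
  note pos = gauss_density_pos[OF Sx] gauss_density_pos[OF m] gauss_density_pos[OF S]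
  have [measurable]: "F \<in> borel_measurable ?L" "q1 \<in> borel_measurable ?L" "q2 \<in> borel_measurable ?L"
    unfolding F_def q1_def q2_def r_def by measurable
  have F_pos: "F p > 0" for p using pos by (simp add: F_def)
  have M: "?M = density ?L (\<lambda>p. ennreal (F p))"
    by (simp add: joint_law_def F_def lborel_prod case_prod_beta')
  \<comment> \<open>Integrating \<open>z\<close> first: for fixed \<open>x\<close> this is the
    quadratic form of the conditional Gaussian under its own law.\<close>
  have I1: "has_bochner_integral ?L (\<lambda>p. F p * q1 p) (real CARD('m))"
  proof (rule has_bochner_integral_nn_integral)
    have "(\<integral>\<^sup>+p. F p * q1 p \<partial>?L) = (\<integral>\<^sup>+x. \<integral>\<^sup>+z. F (x, z) * q1 (x, z) \<partial>lborel \<partial>lborel)"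
      by (rule lborel.nn_integral_fst[symmetric]) measurable
    also have "\<dots> = (\<integral>\<^sup>+x. gauss_density Sx 0 x * ennreal (real CARD('m)) \<partial>lborel)"
      using pos(1) pos_def_inverse_quadratic_nonneg[OF m]
      by (simp add: F_def q1_def ennreal_mult' less_imp_le mult.assoc nn_integral_cmult nn_integral_gauss_density[OF m])
    also have "\<dots> = real CARD('m)"
      by (simp add: nn_integral_multc nn_integral_gauss_density[OF Sx])
    finally show "(\<integral>\<^sup>+p. F p * q1 p \<partial>?L) = real CARD('m)" .
  qed (use F_pos pos_def_inverse_quadratic_nonneg[OF m] in \<open>auto simp: q1_def less_imp_le\<close>)
  have marg: "(\<integral>\<^sup>+x. F (x, z) \<partial>lborel) = gauss_density S b z" for z
    using marginal_output_density[OF Sx s] by (simp add: F_def S_def)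
  \<comment> \<open>Here \<open>x\<close> is integrated first, since \<open>q2\<close> depends on
    \<open>z\<close> only and the marginal is known.\<close>
  have I2: "has_bochner_integral ?L (\<lambda>p. F p * q2 p) (real CARD('m))"
  proof (rule has_bochner_integral_nn_integral)
    have "(\<integral>\<^sup>+p. F p * q2 p \<partial>?L) = (\<integral>\<^sup>+z. \<integral>\<^sup>+x. F (x, z) * q2 (x, z) \<partial>lborel \<partial>lborel)"
      by (rule lborel_pair.nn_integral_snd[symmetric]) measurable
    also have "\<dots> = (\<integral>\<^sup>+z. gauss_density S b z * r z \<partial>lborel)"
    proof (rule nn_integral_cong)
      fix z
      have "r z \<ge> 0"
        using pos_def_inverse_quadratic_nonneg[OF S] by (simp add: r_def)
      then show "(\<integral>\<^sup>+x. F (x, z) * q2 (x, z) \<partial>lborel) = gauss_density S b z * r z"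
        using F_pos pos(3)[of b z] by (simp add: q2_def ennreal_mult less_imp_le nn_integral_multc marg)
    qed
    also have "\<dots> = real CARD('m)"
      by (simp add: r_def nn_integral_gauss_density[OF S])
    finally show "(\<integral>\<^sup>+p. F p * q2 p \<partial>?L) = real CARD('m)" .
  qed (use F_pos pos_def_inverse_quadratic_nonneg[OF S] in \<open>auto simp: q2_def r_def less_imp_le\<close>)
  have I0: "has_bochner_integral ?L F 1"
  proof (rule has_bochner_integral_nn_integral)
    have "(\<integral>\<^sup>+p. F p \<partial>?L) = (\<integral>\<^sup>+z. \<integral>\<^sup>+x. F (x, z) \<partial>lborel \<partial>lborel)"
      by (rule lborel_pair.nn_integral_snd[symmetric]) measurable
    also have "\<dots> = ennreal 1"
      by (simp add: marg nn_integral_gauss_density[OF S])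
    finally show "(\<integral>\<^sup>+p. F p \<partial>?L) = ennreal 1" .
  qed (use F_pos in \<open>auto simp: less_imp_le\<close>)
  have "emeasure ?M (space ?M) = (\<integral>\<^sup>+p. F p \<partial>?L)"
    unfolding M space_density
    by (subst emeasure_density[OF _ sets.top]) (auto intro!: nn_integral_cong simp: indicator_def)
  also have "\<dots> = 1"
    using I0 F_pos by (simp add: has_bochner_integral_iff nn_integral_eq_integral less_imp_le)
  finally have "prob_space ?M"
    by (rule prob_spaceI)
  then interpret information_space ?M "exp 1"
    by (intro information_space.intro) (auto intro!: information_space_axioms.intro)
  have joint: "distributed ?M ?L (\<lambda>p. (fst p, snd p)) F"
    unfolding distributed_def by (auto simp: M distr_id2 measurable_density_eq1 intro!: distr_id2[symmetric])
  have "distributed ?M lborel fst (\<lambda>x. \<integral>\<^sup>+z. F (x, z) \<partial>lborel)"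
    by (rule distr_marginal1[OF _ _ joint]) (simp_all add: lborel.sigma_finite_measure_axioms)
  moreover have "(\<integral>\<^sup>+z. F (x, z) \<partial>lborel) = gauss_density Sx 0 x" for x
    using pos by (simp add: F_def ennreal_mult less_imp_le nn_integral_cmult nn_integral_gauss_density[OF m])
  ultimately have dX: "distributed ?M lborel fst (gauss_density Sx 0)" by simp
  have "distributed ?M lborel snd (\<lambda>z. \<integral>\<^sup>+x. F (x, z) \<partial>lborel)"
    by (rule distr_marginal2[OF _ _ joint]) (simp_all add: lborel.sigma_finite_measure_axioms)
  then have dZ: "distributed ?M lborel snd (gauss_density S b)" by (simp add: marg)
  have "MI_Wb Sx s W b = (\<integral>p. F p * log (exp 1) (F p / (gauss_density Sx 0 (fst p) * gauss_density S b (snd p))) \<partial>?L)"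
    unfolding MI_Wb_def
    by (rule mutual_information_distr[OF _ _ dX _ dZ _ joint])
       (use pos F_pos in \<open>auto simp: less_imp_le lborel.sigma_finite_measure_axioms\<close>)
  also have "\<dots> = (\<integral>p. 1/2 * ln (det S / s ^ CARD('m)) * F p + (F p * q2 p / 2 - F p * q1 p / 2) \<partial>?L)"
  proof (intro Bochner_Integration.integral_cong refl)
    fix p
    \<comment> \<open>\<open>a1\<close> and \<open>a2\<close> normalise the marginal and the
      conditional density; their powers of \<open>2 * pi\<close> cancel in the quotient.\<close>
    define a1 where "a1 = sqrt ((2 * pi) ^ CARD('m) * det S)"
    define a2 where "a2 = sqrt ((2 * pi) ^ CARD('m) * det (mat s :: real^'m^'m))"
    have a: "a1 > 0" "a2 > 0" using pos_def_det_pos[OF S] pos_def_det_pos[OF m] by (simp_all add: a1_def a2_def)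
    have "F p / (gauss_density Sx 0 (fst p) * gauss_density S b (snd p)) =
      gauss_density (mat s) (W *v fst p + b) (snd p) / gauss_density S b (snd p)"
      using pos(1)[of 0 "fst p"] by (simp add: F_def)
    also have "\<dots> = exp (- (1/2) * q1 p) / a2 / (exp (- (1/2) * q2 p) / a1)"
      by (simp only: gauss_density_def q1_def q2_def r_def a1_def a2_def)
    also have "\<dots> = a1 / a2 * exp (q2 p / 2 - q1 p / 2)"
      by (simp only: exp_diff mult_minus_left exp_minus) (simp add: divide_simps)
    finally have "ln (F p / (gauss_density Sx 0 (fst p) * gauss_density S b (snd p))) = ln (a1 / a2 * exp (q2 p / 2 - q1 p / 2))"
      by simp
    also have "\<dots> = ln (a1 / a2) + (q2 p / 2 - q1 p / 2)"
      using a by (subst ln_mult) auto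
    finally have "ln (F p / (gauss_density Sx 0 (fst p) * gauss_density S b (snd p))) = ln (a1 / a2) + (q2 p / 2 - q1 p / 2)" .
    moreover have "a1 / a2 = sqrt (det S / s ^ CARD('m))"
      by (simp add: a1_def a2_def det_mat real_sqrt_mult real_sqrt_divide)
    ultimately have "log (exp 1) (F p / (gauss_density Sx 0 (fst p) * gauss_density S b (snd p))) =
        1/2 * ln (det S / s ^ CARD('m)) + (q2 p / 2 - q1 p / 2)"
      using s pos_def_det_pos[OF S] by (simp add: log_def ln_sqrt)
    then show "F p * log (exp 1) (F p / (gauss_density Sx 0 (fst p) * gauss_density S b (snd p))) =
        1/2 * ln (det S / s ^ CARD('m)) * F p + (F p * q2 p / 2 - F p * q1 p / 2)"
      by (simp only:) (simp add: algebra_simps)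
  qed
  also have "\<dots> = 1/2 * ln (det S / s ^ CARD('m))"
    using I0 I1 I2 by (simp add: has_bochner_integral_iff)
  finally show ?thesis by (simp add: S_def)
qed

section \<open>Rearrangement and trace inequalities\<close>

lemma bij_betw_insert_upd:
  assumes "bij_betw f A B" "a \<notin> A" "b \<notin> B"
  shows "bij_betw (f(a := b)) (insert a A) (insert b B)"
proof -
  have "bij_betw (f(a := b)) A B"
    using assms(1,2) by (subst bij_betw_cong[of A _ f]) auto
  then show ?thesis
    using notIn_Un_bij_betw[of a A "f(a := b)" B] assms(2,3) by simp
qed

text \<open>Roots are matched with multiplicity: \<open>l b\<close> is a root of the other product,
  so some \<open>d a\<close> equals it; cancel that factor and induct.\<close>

lemma equal_linear_products_bij:
  fixes d :: "'a \<Rightarrow> real" and l :: "'b \<Rightarrow> real"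
  assumes "finite A" "finite B" "\<And>t. (\<Prod>i\<in>A. d i - t) = (\<Prod>j\<in>B. l j - t)"
  shows "\<exists>\<beta>. bij_betw \<beta> B A \<and> (\<forall>j\<in>B. d (\<beta> j) = l j)"
proof -
  \<comment> \<open>Passing to polynomials allows cancelling a linear factor, which fails pointwise
    at its root.\<close>
  have "(\<Prod>i\<in>A. [:d i, -1:]) = (\<Prod>j\<in>B. [:l j, -1:])"
    using assms(3) by (intro poly_eq_poly_eq_iff[THEN iffD1] ext) (simp add: poly_prod)
  with \<open>finite B\<close> \<open>finite A\<close> show ?thesis
  proof (induction B arbitrary: A rule: finite_induct)
    case empty
    have "A = {}"
    proof (rule ccontr)
      assume "A \<noteq> {}"
      then obtain a where "a \<in> A" by blast
      then have "poly (\<Prod>i\<in>A. [:d i, -1:]) (d a) = 0"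
        using empty.prems(1) by (auto simp: poly_prod)
      with empty.prems(2) show False by simp
    qed
    then show ?case by (simp add: bij_betw_def)
  next
    case (insert b B)
    have "poly (\<Prod>i\<in>A. [:d i, -1:]) (l b) = 0"
      using insert.hyps by (simp add: insert.prems(2))
    then obtain a where a: "a \<in> A" "d a = l b"
      using insert.prems(1) by (auto simp: poly_prod)
    have "[:l b, -1:] * (\<Prod>i\<in>A - {a}. [:d i, -1:]) = [:l b, -1:] * (\<Prod>j\<in>B. [:l j, -1:])"
      using insert.prems insert.hyps a prod.remove[OF insert.prems(1) a(1), of "\<lambda>i. [:d i, -1:]"] by simp
    then have "(\<Prod>i\<in>A - {a}. [:d i, -1:]) = (\<Prod>j\<in>B. [:l j, -1:])"
      by (subst (asm) mult_left_cancel) auto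
    then obtain \<beta> where \<beta>: "bij_betw \<beta> B (A - {a})" "\<forall>j\<in>B. d (\<beta> j) = l j"
      using insert.IH[of "A - {a}"] insert.prems(1) by blast
    have "bij_betw (\<beta>(b := a)) (insert b B) (insert a (A - {a}))"
      using \<beta>(1) insert.hyps(2) by (intro bij_betw_insert_upd) auto
    moreover have "insert a (A - {a}) = A"
      using a(1) by auto
    moreover have "\<forall>j\<in>insert b B. d ((\<beta>(b := a)) j) = l j"
      using \<beta>(2) a(2) insert.hyps(2) by auto
    ultimately show ?case by metis
  qed
qed

text \<open>Bathtub principle: a total weight \<open>r\<close> with at most 1 per index is cheapest
  when it fills the first \<open>r\<close> indices. Subtracting \<open>\<alpha> r\<close> from the
  costs is free because both weightings have the same total, and then every term of the difference
  is nonnegative.\<close>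

lemma sum_weights_ge_smallest:
  fixes \<alpha> c :: "nat \<Rightarrow> real"
  assumes mono: "\<And>i j. 1 \<le> i \<Longrightarrow> i \<le> j \<Longrightarrow> j \<le> n \<Longrightarrow> \<alpha> i \<le> \<alpha> j"
    and c: "\<And>j. j \<in> {1..n} \<Longrightarrow> 0 \<le> c j \<and> c j \<le> 1" "(\<Sum>j=1..n. c j) = real r"
  shows "(\<Sum>j=1..r. \<alpha> j) \<le> (\<Sum>j=1..n. \<alpha> j * c j)"
proof -
  have "(\<Sum>j=1..n. c j) \<le> (\<Sum>j=1..n. 1)"
    using c(1) by (intro sum_mono) auto
  then have "r \<le> n" using c(2) by simp
  have ind: "(\<Sum>j=1..n. f j * of_bool (j \<le> r)) = (\<Sum>j=1..r. f j)" for f :: "nat \<Rightarrow> real"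
    using \<open>r \<le> n\<close> by (intro sum.mono_neutral_cong_right) auto
  have "0 \<le> (\<Sum>j=1..n. (\<alpha> j - \<alpha> r) * (c j - of_bool (j \<le> r)))"
  proof (intro sum_nonneg)
    fix j assume j: "j \<in> {1..n}"
    show "0 \<le> (\<alpha> j - \<alpha> r) * (c j - of_bool (j \<le> r))"
    proof (cases "r = 0 \<or> j \<le> r")
      case False
      then show ?thesis using mono[of r j] j c(1)[OF j] by simp
    next
      case True
      then show ?thesis
      proof
        \<comment> \<open>\<open>\<alpha> 0\<close> lies outside the range of monotonicity, but then
          all weights vanish.\<close>
        assume "r = 0"
        then have "c j = 0"
          using c j sum_nonneg_eq_0_iff[of "{1..n}" c] by auto
        then show ?thesis using \<open>r = 0\<close> j by simp
      next
        assume "j \<le> r"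
        then show ?thesis using mono[of j r] j \<open>r \<le> n\<close> c(1)[OF j]
          by (simp add: mult_nonpos_nonpos)
      qed
    qed
  qed
  also have "\<dots> = (\<Sum>j=1..n. \<alpha> j * c j) - (\<Sum>j=1..n. \<alpha> j * of_bool (j \<le> r))
      - \<alpha> r * ((\<Sum>j=1..n. c j) - (\<Sum>j=1..n. 1 * of_bool (j \<le> r)))"
    by (simp add: algebra_simps sum.distrib sum_subtractf sum_distrib_left)
  also have "\<dots> = (\<Sum>j=1..n. \<alpha> j * c j) - (\<Sum>j=1..r. \<alpha> j)"
    unfolding ind c(2) by simp
  finally show ?thesis by simp
qed

lemma Bessel_inequality:
  fixes q :: "'i \<Rightarrow> 'a::real_inner"
  assumes "finite I" and q: "\<And>i j. i \<in> I \<Longrightarrow> j \<in> I \<Longrightarrow> q i \<bullet> q j = (if i = j then 1 else 0)"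
  shows "(\<Sum>i\<in>I. (q i \<bullet> x)\<^sup>2) \<le> x \<bullet> x"
proof -
  define y where "y = (\<Sum>i\<in>I. (q i \<bullet> x) *\<^sub>R q i)"
  have "q i \<bullet> y = q i \<bullet> x" if "i \<in> I" for i
    using that assms(1) by (simp add: y_def inner_sum_right q if_distrib cong: if_cong sum.cong)
  then have "y \<bullet> y = (\<Sum>i\<in>I. (q i \<bullet> x)\<^sup>2)"
    by (subst (1) y_def) (simp add: inner_sum_left power2_eq_square)
  moreover have "y \<bullet> x = (\<Sum>i\<in>I. (q i \<bullet> x)\<^sup>2)"
    by (simp add: y_def inner_sum_left power2_eq_square)
  moreover have "0 \<le> (x - y) \<bullet> (x - y)" by simp
  ultimately show ?thesis
    by (simp add: inner_diff_left inner_diff_right inner_commute[of x y])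
qed

text \<open>The total mass \<open>c k\<close> that the vectors put on coordinate \<open>k\<close> is
  at most 1 by Bessel's inequality for \<open>axis k 1\<close>, and these masses add up to
  \<open>card I\<close>. The bathtub principle then applies along the increasing enumeration
  \<open>\<beta>\<close>.\<close>

lemma Ky_Fan_diagonal:
  fixes q :: "'i \<Rightarrow> real^'n"
  assumes "finite I" and q: "\<And>i j. i \<in> I \<Longrightarrow> j \<in> I \<Longrightarrow> q i \<bullet> q j = (if i = j then 1 else 0)"
    and \<beta>: "bij_betw \<beta> {1..CARD('n)} UNIV"
    and mono: "\<And>i j. 1 \<le> i \<Longrightarrow> i \<le> j \<Longrightarrow> j \<le> CARD('n) \<Longrightarrow> a (\<beta> i) \<le> a (\<beta> j)"
  shows "card I \<le> CARD('n)"
    and "(\<Sum>j=1..card I. a (\<beta> j)) \<le> (\<Sum>i\<in>I. \<Sum>k\<in>UNIV. (q i $ k)\<^sup>2 * a k)"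
proof -
  define c where "c k = (\<Sum>i\<in>I. (q i $ k)\<^sup>2)" for k
  have c01: "0 \<le> c k" "c k \<le> 1" for k
    using Bessel_inequality[OF assms(1) q, of "axis k 1"]
    by (simp_all add: c_def sum_nonneg inner_axis inner_axis_axis)
  have reindex: "(\<Sum>j=1..CARD('n). f (\<beta> j)) = (\<Sum>k\<in>UNIV. f k)" for f :: "'n \<Rightarrow> real"
    by (rule sum.reindex_bij_betw[OF \<beta>])
  have "(\<Sum>k\<in>UNIV. c k) = (\<Sum>i\<in>I. q i \<bullet> q i)"
    unfolding c_def by (subst sum.swap) (simp add: inner_vec_def power2_eq_square)
  also have "\<dots> = card I" using q by simp
  finally have sum_c: "(\<Sum>k\<in>UNIV. c k) = card I" .
  have "(\<Sum>k\<in>UNIV. c k) \<le> (\<Sum>k\<in>(UNIV::'n set). 1)"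
    by (intro sum_mono c01)
  then show "card I \<le> CARD('n)" by (simp add: sum_c)
  have "(\<Sum>j=1..card I. a (\<beta> j)) \<le> (\<Sum>j=1..CARD('n). a (\<beta> j) * c (\<beta> j))"
    by (rule sum_weights_ge_smallest) (auto simp: c01 mono reindex[of c] sum_c[symmetric] simp del: One_nat_def)
  also have "\<dots> = (\<Sum>k\<in>UNIV. a k * c k)"
    by (rule reindex)
  also have "\<dots> = (\<Sum>i\<in>I. \<Sum>k\<in>UNIV. (q i $ k)\<^sup>2 * a k)"
    unfolding c_def sum_distrib_left by (subst sum.swap) (simp add: mult.commute)
  finally show "(\<Sum>j=1..card I. a (\<beta> j)) \<le> (\<Sum>i\<in>I. \<Sum>k\<in>UNIV. (q i $ k)\<^sup>2 * a k)" .
qed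

text \<open>By induction on the size of \<open>I\<close>: subtract the least weight from all weights and drop its index.\<close>
lemma weighted_sum_ge_rearranged:
  fixes \<theta> e :: "'i \<Rightarrow> real" and \<alpha> :: "nat \<Rightarrow> real"
  assumes "finite I" "\<And>i. i \<in> I \<Longrightarrow> \<theta> i \<ge> 0"
    and "\<And>J. J \<subseteq> I \<Longrightarrow> (\<Sum>j=1..card J. \<alpha> j) \<le> (\<Sum>i\<in>J. e i)"
  shows "\<exists>\<sigma>. bij_betw \<sigma> I {1..card I} \<and> (\<Sum>i\<in>I. \<theta> i * \<alpha> (\<sigma> i)) \<le> (\<Sum>i\<in>I. \<theta> i * e i)"
  using assms
proof (induction "card I" arbitrary: I \<theta>)
  case 0
  then show ?case by (auto simp: bij_betw_def)
next
  case (Suc r)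
  then have "I \<noteq> {}" by auto
  then obtain m where m: "m \<in> I" "\<And>i. i \<in> I \<Longrightarrow> \<theta> m \<le> \<theta> i"
    using Suc.prems(1) by (metis arg_min_if_finite(1) arg_min_least)
  define I' where "I' = I - {m}"
  have I': "card I' = r" "I = insert m I'" "m \<notin> I'" "finite I'"
    using Suc.hyps(2) Suc.prems(1) m(1) by (auto simp: I'_def)
  obtain \<sigma>' where \<sigma>': "bij_betw \<sigma>' I' {1..r}"
      "(\<Sum>i\<in>I'. (\<theta> i - \<theta> m) * \<alpha> (\<sigma>' i)) \<le> (\<Sum>i\<in>I'. (\<theta> i - \<theta> m) * e i)"
    using Suc.hyps(1)[of I' "\<lambda>i. \<theta> i - \<theta> m"] I' Suc.prems(3) m(2) by (auto simp: subset_insertI2)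
  define \<sigma> where "\<sigma> = \<sigma>'(m := Suc r)"
  have "bij_betw \<sigma> (insert m I') (insert (Suc r) {1..r})"
    using \<sigma>'(1) I'(3) unfolding \<sigma>_def by (intro bij_betw_insert_upd) auto
  moreover have "insert (Suc r) {1..r} = {1..card I}"
    using Suc.hyps(2) by auto
  ultimately have \<sigma>: "bij_betw \<sigma> I {1..card I}"
    using I'(2) by simp
  have \<sigma>_eq: "(\<Sum>i\<in>I'. (\<theta> i - \<theta> m) * \<alpha> (\<sigma> i)) = (\<Sum>i\<in>I'. (\<theta> i - \<theta> m) * \<alpha> (\<sigma>' i))"
    using I'(3) by (intro sum.cong) (auto simp: \<sigma>_def)
  \<comment> \<open>The excess over the least weight vanishes at \<open>m\<close> and falls to the
    induction hypothesis; the common part is bounded by the assumption for the full set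
    \<open>I\<close>.\<close>
  have split: "(\<Sum>i\<in>I. \<theta> i * f i) = (\<Sum>i\<in>I'. (\<theta> i - \<theta> m) * f i) + \<theta> m * (\<Sum>i\<in>I. f i)" for f
    using I' by (simp add: algebra_simps sum.distrib sum_distrib_left sum_subtractf)
  have "(\<Sum>i\<in>I. \<alpha> (\<sigma> i)) \<le> (\<Sum>i\<in>I. e i)"
    using sum.reindex_bij_betw[OF \<sigma>, of \<alpha>] Suc.prems(3)[of I] by simp
  then have "\<theta> m * (\<Sum>i\<in>I. \<alpha> (\<sigma> i)) \<le> \<theta> m * (\<Sum>i\<in>I. e i)"
    using Suc.prems(2)[OF m(1)] by (rule mult_left_mono)
  then have "(\<Sum>i\<in>I. \<theta> i * \<alpha> (\<sigma> i)) \<le> (\<Sum>i\<in>I. \<theta> i * e i)"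
    using \<sigma>'(2) unfolding split \<sigma>_eq by simp
  with \<sigma> show ?case by blast
qed

lemma arith_geom_mean_power:
  fixes x :: "'a \<Rightarrow> real"
  assumes "finite S" "S \<noteq> {}" "\<And>i. i \<in> S \<Longrightarrow> x i \<ge> 0"
  shows "(\<Prod>i\<in>S. x i) \<le> ((\<Sum>i\<in>S. x i) / card S) ^ card S"
proof -
  have c: "real (card S) > 0" using assms by (simp add: card_gt_0_iff)
  have p: "(\<Prod>i\<in>S. x i) \<ge> 0" using assms(3) by (simp add: prod_nonneg)
  have "(\<Prod>i\<in>S. x i) = ((\<Prod>i\<in>S. x i) powr (1 / card S)) ^ card S"
    using c p by (cases "(\<Prod>i\<in>S. x i) = 0") (auto simp: powr_powr simp flip: powr_realpow intro: card_gt_0_iff)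
  also have "\<dots> \<le> (\<Sum>i\<in>S. x i / card S) ^ card S"
    by (intro power_mono arith_geom_mean assms powr_ge_zero)
  finally show ?thesis by (simp add: sum_divide_distrib)
qed

section \<open>Optimal power allocation\<close>

lemma trace_transpose_mult_rows:
  "trace (transpose W ** W) = (\<Sum>i\<in>UNIV. W $ i \<bullet> W $ i)" for W :: "real^'n^'m"
  unfolding trace_def matrix_matrix_mult_def transpose_def inner_vec_def
  by simp (rule sum.swap)

text \<open>Parseval's identity applied to each column: the power may be measured in any rotated
  system of rows, in particular an eigenbasis of the output signal covariance.\<close>

lemma trace_transpose_mult_orthonormal:
  fixes W :: "real^'n^'m"
  assumes p: "orthonormal p"
  shows "trace (transpose W ** W) = (\<Sum>i\<in>UNIV. (p i v* W) \<bullet> (p i v* W))"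
proof -
  have "(p i v* W) $ k = p i \<bullet> column k W" for i k
    by (simp add: vector_matrix_mult_def column_def inner_vec_def mult.commute)
  then have "(\<Sum>i\<in>UNIV. (p i v* W) \<bullet> (p i v* W)) = (\<Sum>k\<in>UNIV. \<Sum>i\<in>UNIV. (p i \<bullet> column k W) * (p i \<bullet> column k W))"
    by (simp add: inner_vec_def) (rule sum.swap)
  also have "\<dots> = (\<Sum>k\<in>UNIV. column k W \<bullet> column k W)"
    by (simp add: orthonormal_inner[OF p, symmetric])
  also have "\<dots> = trace (transpose W ** W)"
    by (simp add: trace_def matrix_matrix_mult_def transpose_def column_def inner_vec_def)
  finally show ?thesis by simp
qed

text \<open>Links the ordered eigenvalues, given only through the characteristic polynomial, to the
  members of an eigenbasis.\<close>

lemma eigenvalue_enumeration: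
  fixes A :: "real^'n^'n"
  assumes "orthonormal u" "\<And>i. A *v u i = d i *\<^sub>R u i"
    and "\<And>t. det (A - mat t) = (\<Prod>j=1..CARD('n). l j - t)"
  obtains \<beta> where "bij_betw \<beta> {1..CARD('n)} UNIV" "\<And>j. j \<in> {1..CARD('n)} \<Longrightarrow> d (\<beta> j) = l j"
proof -
  have "(\<Prod>i\<in>UNIV. d i - t) = (\<Prod>j=1..CARD('n). l j - t)" for t
  proof -
    have "A - mat t = A + mat (- t)"
      by (simp add: vec_eq_iff mat_def)
    then have "(\<Prod>i\<in>UNIV. d i + - t) = (\<Prod>j=1..CARD('n). l j - t)"
      using det_shift_eigenbasis[OF assms(1,2), of "- t"] assms(3)[of t] by metis
    then show ?thesis by simp
  qed
  then show thesis
    using equal_linear_products_bij[of UNIV "{1..CARD('n)}" d l] that by auto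
qed

section \<open>Upper bound and water-filling for a fixed spectral decomposition of the input
  covariance\<close>

context
  fixes Sx :: "real^'n^'n" and s :: real and u :: "'n \<Rightarrow> real^'n" and d :: "'n \<Rightarrow> real"
    and lam :: "nat \<Rightarrow> real" and \<beta> :: "nat \<Rightarrow> 'n"
  assumes Sx: "pos_def_matrix Sx" and s: "s > 0"
    and u: "orthonormal u" "\<And>i. Sx *v u i = d i *\<^sub>R u i"
    and \<beta>: "bij_betw \<beta> {1..CARD('n)} UNIV" "\<And>j. j \<in> {1..CARD('n)} \<Longrightarrow> d (\<beta> j) = lam j"
    and mono: "\<And>i j. 1 \<le> i \<Longrightarrow> i \<le> j \<Longrightarrow> j \<le> CARD('n) \<Longrightarrow> lam j \<le> lam i"
begin

lemma lam_pos: "j \<in> {1..CARD('n)} \<Longrightarrow> lam j > 0"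
  using \<beta>(2) pos_def_eigenvalues_pos[OF Sx u] by metis

text \<open>The rows of \<open>W\<close> in an eigenbasis of \<open>W \<Sigma> W\<^sup>T\<close> are \<open>\<Sigma>\<close>-orthogonal, so normalising
  \<open>\<Sigma>\<^sup>1\<^sup>/\<^sup>2\<close> times them gives orthonormal vectors \<open>q\<close>, and the power spent on a row is its
  eigenvalue \<open>\<theta>\<close> times the quadratic form of \<open>\<Sigma>\<^sup>-\<^sup>1\<close> at \<open>q\<close>.\<close>
lemma power_allocation:
  fixes W :: "real^'n^'m"
  defines "N \<equiv> min CARD('n) CARD('m)"
  obtains t :: "nat \<Rightarrow> real" where "\<And>j. t j \<ge> 0"
    and "(\<Sum>j=1..N. t j / lam j) \<le> trace (transpose W ** W)"
    and "det (output_cov Sx s W) / s ^ CARD('m) = (\<Prod>j=1..N. 1 + t j / s)"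
proof -
  define K where "K = W ** Sx ** transpose W"
  have "transpose K = K"
    using Sx by (simp add: K_def matrix_transpose_mul matrix_mul_assoc pos_def_matrix_def)
  then obtain p \<theta> where p: "orthonormal p" "\<And>i. K *v p i = \<theta> i *\<^sub>R p i"
    using symmetric_matrix_eigenbasis by blast
  define w where "w i = p i v* W" for i
  have w_orth: "w i \<bullet> (Sx *v w j) = (if i = j then \<theta> i else 0)" for i j
  proof -
    have "w i \<bullet> (Sx *v w j) = p i \<bullet> (K *v p j)"
      by (simp add: w_def K_def dot_lmul_matrix flip: matrix_vector_mul_assoc)
    then show ?thesis
      by (simp add: p orthonormalD)
  qed
  have \<theta>: "\<theta> i \<ge> 0" for i
    using w_orth[of i i] Sx by (cases "w i = 0") (force simp: pos_def_matrix_def)+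
  have d: "d k > 0" for k by (rule pos_def_eigenvalues_pos[OF Sx u])
  \<comment> \<open>Restricting to positive eigenvalues makes the normalisation by
    \<open>sqrt (\<theta> i)\<close> legitimate; the other indices contribute factors 1 to the
    determinant ratio.\<close>
  define I where "I = {i. \<theta> i > 0}"
  \<comment> \<open>Written in coordinates with respect to \<open>u\<close>, where the square root
    of \<open>Sx\<close> multiplies coordinate \<open>k\<close> by
    \<open>sqrt (d k)\<close>.\<close>
  define q where "q i = (\<chi> k. sqrt (d k) * (u k \<bullet> w i) / sqrt (\<theta> i))" for i
  have q: "q i \<bullet> q j = (if i = j then 1 else 0)" if "i \<in> I" "j \<in> I" for i j
  proof -
    have "q i \<bullet> q j = (\<Sum>k\<in>UNIV. (u k \<bullet> w i) * (d k * (u k \<bullet> w j))) / (sqrt (\<theta> i) * sqrt (\<theta> j))"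
    proof -
      have "q i $ k * q j $ k = (u k \<bullet> w i) * (d k * (u k \<bullet> w j)) / (sqrt (\<theta> i) * sqrt (\<theta> j))" for k
        using real_sqrt_mult_self[of "d k"] d[of k] by (simp add: q_def)
      then show ?thesis
        by (subst inner_vec_def) (simp add: sum_divide_distrib)
    qed
    also have "(\<Sum>k\<in>UNIV. (u k \<bullet> w i) * (d k * (u k \<bullet> w j))) = w i \<bullet> (Sx *v w j)"
      unfolding orthonormal_inner[OF u(1), of "w i" "Sx *v w j"]
      unfolding eigenbasis_mult[OF u] orthonormal_coordinate[OF u(1)] ..
    finally show ?thesis
      using that by (simp add: w_orth I_def)
  qed
  define e where "e i = (\<Sum>k\<in>UNIV. (q i $ k)\<^sup>2 * (1 / d k))" for i
  have e: "\<theta> i * e i = w i \<bullet> w i" if "i \<in> I" for i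
  proof -
    have "\<theta> i * ((q i $ k)\<^sup>2 * (1 / d k)) = (u k \<bullet> w i)\<^sup>2" for k
      using that d[of k] by (simp add: q_def I_def power_divide power_mult_distrib)
    then show ?thesis
      by (simp add: e_def sum_distrib_left orthonormal_inner[OF u(1), of "w i" "w i"] power2_eq_square[symmetric])
  qed
  have anti: "1 / d (\<beta> i) \<le> 1 / d (\<beta> j)" if "1 \<le> i" "i \<le> j" "j \<le> CARD('n)" for i j
    using that mono[OF that] lam_pos[of i] lam_pos[of j] by (simp add: \<beta>(2) frac_le)
  note KF = Ky_Fan_diagonal[where q=q and a="\<lambda>k. 1 / d k", OF _ _ \<beta>(1) anti]
  have "(\<Sum>j=1..card J. 1 / d (\<beta> j)) \<le> (\<Sum>i\<in>J. e i)" if "J \<subseteq> I" for J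
    unfolding e_def
  proof (rule KF(2))
    show "q i \<bullet> q j = (if i = j then 1 else 0)" if "i \<in> J" "j \<in> J" for i j
      using that \<open>J \<subseteq> I\<close> by (intro q) auto
  qed simp
  then obtain \<sigma> where \<sigma>: "bij_betw \<sigma> I {1..card I}"
      "(\<Sum>i\<in>I. \<theta> i * (1 / d (\<beta> (\<sigma> i)))) \<le> (\<Sum>i\<in>I. \<theta> i * e i)"
    using weighted_sum_ge_rearranged[of I \<theta> "\<lambda>j. 1 / d (\<beta> j)" e] \<theta> by auto
  \<comment> \<open>Rank bound: the \<open>q i\<close> are orthonormal in dimension
    \<open>CARD('n)\<close>, and \<open>I\<close> is a set of output indices.\<close>
  have card: "card I \<le> CARD('n)" "card I \<le> N"
    using KF(1)[of I] q card_mono[of UNIV I] by (auto simp: N_def)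
  \<comment> \<open>The eigenvalues carried to the positions chosen by \<open>\<sigma>\<close>. The
    default 0 marks idle channels, so sums and products extend from \<open>card I\<close> to
    \<open>N\<close> unchanged.\<close>
  define t where "t j = (if j \<in> {1..card I} then \<theta> (inv_into I \<sigma> j) else 0)" for j
  have t: "t (\<sigma> i) = \<theta> i" if "i \<in> I" for i
    using that \<sigma>(1) by (auto simp: t_def bij_betw_def)
  show thesis
  proof
    show "t j \<ge> 0" for j by (simp add: t_def \<theta>)
    have "(\<Sum>j=1..N. t j / lam j) = (\<Sum>j=1..card I. t j / lam j)"
      using card(2) by (intro sum.mono_neutral_right) (auto simp: t_def)
    also have "\<dots> = (\<Sum>i\<in>I. t (\<sigma> i) / lam (\<sigma> i))"
      by (rule sum.reindex_bij_betw[OF \<sigma>(1), symmetric])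
    also have "\<dots> = (\<Sum>i\<in>I. \<theta> i * (1 / d (\<beta> (\<sigma> i))))"
    proof (intro sum.cong refl)
      fix i assume i: "i \<in> I"
      then have "\<sigma> i \<in> {1..CARD('n)}"
        using bij_betw_apply[OF \<sigma>(1) i] card(1) by simp
      then show "t (\<sigma> i) / lam (\<sigma> i) = \<theta> i * (1 / d (\<beta> (\<sigma> i)))"
        using t[OF i] \<beta>(2) by simp
    qed
    also have "\<dots> \<le> (\<Sum>i\<in>I. w i \<bullet> w i)"
      using \<sigma>(2) by (simp add: e)
    also have "\<dots> \<le> (\<Sum>i\<in>UNIV. w i \<bullet> w i)"
      by (intro sum_mono2) auto
    also have "\<dots> = trace (transpose W ** W)"
      by (simp add: w_def trace_transpose_mult_orthonormal[OF p(1)])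
    finally show "(\<Sum>j=1..N. t j / lam j) \<le> trace (transpose W ** W)" .
    have "det (output_cov Sx s W) / s ^ CARD('m) = (\<Prod>i\<in>UNIV. (\<theta> i + s) / s)"
      using det_shift_eigenbasis[OF p, of s] by (simp add: output_cov_def K_def prod_dividef)
    also have "\<dots> = (\<Prod>i\<in>I. 1 + t (\<sigma> i) / s)"
      using s \<theta> by (intro prod.mono_neutral_cong_right) (auto simp: I_def t add_divide_distrib not_less le_less)
    also have "\<dots> = (\<Prod>j=1..card I. 1 + t j / s)"
      by (rule prod.reindex_bij_betw[OF \<sigma>(1)])
    also have "\<dots> = (\<Prod>j=1..N. 1 + t j / s)"
      using card(2) by (intro prod.mono_neutral_left) (auto simp: t_def)
    finally show "det (output_cov Sx s W) / s ^ CARD('m) = (\<Prod>j=1..N. 1 + t j / s)" .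
  qed
qed

text \<open>Dividing factor \<open>j\<close> by \<open>lam j\<close> makes the sum of the factors
  depend on the allocation only through the total power, so AM-GM gives a bound in \<open>F\<close>
  alone.\<close>

lemma det_output_cov_le:
  fixes W :: "real^'n^'m"
  defines "N \<equiv> min CARD('n) CARD('m)"
  assumes F: "trace (transpose W ** W) \<le> F"
  shows "det (output_cov Sx s W) / s ^ CARD('m) \<le>
    ((F + s * (\<Sum>j=1..N. 1 / lam j)) / (s * real N)) ^ N * (\<Prod>j=1..N. lam j)"
proof -
  obtain t where t: "\<And>j. t j \<ge> 0" "(\<Sum>j=1..N. t j / lam j) \<le> trace (transpose W ** W)"
      "det (output_cov Sx s W) / s ^ CARD('m) = (\<Prod>j=1..N. 1 + t j / s)"
    using power_allocation[of W] unfolding N_def by blast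
  have N: "N \<ge> 1" "N \<le> CARD('n)" by (simp_all add: N_def Suc_le_eq)
  have lam: "lam j > 0" if "j \<in> {1..N}" for j
    using lam_pos that N(2) by simp
  have "(\<Prod>j=1..N. (1 + t j / s) * (1 / lam j)) \<le> ((\<Sum>j=1..N. (1 + t j / s) * (1 / lam j)) / card {1..N}) ^ card {1..N}"
    using lam s t(1) N(1) by (intro arith_geom_mean_power) (auto simp: less_imp_le)
  also have "(\<Sum>j=1..N. (1 + t j / s) * (1 / lam j)) = (\<Sum>j=1..N. t j / lam j) / s + (\<Sum>j=1..N. 1 / lam j)"
    by (simp add: sum.distrib sum_divide_distrib add_divide_distrib add.commute mult.commute)
  also have "(((\<Sum>j=1..N. t j / lam j) / s + (\<Sum>j=1..N. 1 / lam j)) / card {1..N}) ^ card {1..N} \<le>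
      ((F / s + (\<Sum>j=1..N. 1 / lam j)) / N) ^ N"
    using t(1,2) F lam s unfolding card_atLeastAtMost add_diff_cancel_right' diff_Suc_1
    by (simp, intro power_mono divide_right_mono add_right_mono)
       (auto intro!: sum_nonneg add_nonneg_nonneg divide_nonneg_nonneg simp: less_imp_le)
  also have "(F / s + (\<Sum>j=1..N. 1 / lam j)) / N = (F + s * (\<Sum>j=1..N. 1 / lam j)) / (s * real N)"
    using s by (simp add: field_simps)
  finally have "(\<Prod>j=1..N. (1 + t j / s) * (1 / lam j)) * (\<Prod>j=1..N. lam j) \<le>
      ((F + s * (\<Sum>j=1..N. 1 / lam j)) / (s * real N)) ^ N * (\<Prod>j=1..N. lam j)"
    using lam by (intro mult_right_mono prod_nonneg) (auto simp: less_imp_le)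
  moreover have "(\<Prod>j=1..N. (1 + t j / s) * (1 / lam j)) * (\<Prod>j=1..N. lam j) = (\<Prod>j=1..N. 1 + t j / s)"
    unfolding prod.distrib[symmetric] using lam by (intro prod.cong) force+
  ultimately show ?thesis by (simp add: t(3))
qed

text \<open>The rows of the optimal \<open>W\<close> are scaled eigenvectors of \<open>Sx\<close>
  for the \<open>N\<close> largest eigenvalues, with powers set by water-filling.\<close>

lemma det_output_cov_attained:
  fixes F :: real
  defines "N \<equiv> min CARD('n) CARD('m::finite)"
  assumes F: "F \<ge> rho s lam N"
  obtains W :: "real^'n^'m" where "trace (transpose W ** W) = F"
    and "det (output_cov Sx s W) / s ^ CARD('m) =
    ((F + s * (\<Sum>j=1..N. 1 / lam j)) / (s * real N)) ^ N * (\<Prod>j=1..N. lam j)"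
proof -
  have N: "N \<ge> 1" "N \<le> CARD('n)" "N \<le> CARD('m)" by (simp_all add: N_def Suc_le_eq)
  \<comment> \<open>The water level, fixed by the requirement that the powers \<open>g j\<close> add
    up to \<open>F\<close>.\<close>
  define \<nu> where "\<nu> = (F + s * (\<Sum>j=1..N. 1 / lam j)) / (s * real N)"
  define g where "g j = s * (\<nu> - 1 / lam j)" for j
  have lam: "lam j > 0" if "j \<in> {1..N}" for j
    using lam_pos that N(2) by simp
  \<comment> \<open>This is the assumption on \<open>F\<close> rearranged. Channel \<open>N\<close>
    is the weakest, so all powers are nonnegative.\<close>
  have "1 / lam N \<le> \<nu>"
    using F N(1) s by (simp add: \<nu>_def rho_def field_simps)
  then have g: "g j \<ge> 0" if "j \<in> {1..N}" for j
    using mono[of j N] that N lam[of j] lam[of N] s frac_le[of 1 1 "lam N" "lam j"]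
    by (simp add: g_def)
  have sum_g: "(\<Sum>j=1..N. g j) = F"
  proof -
    have "(\<Sum>j=1..N. g j) = s * (real N * \<nu> - (\<Sum>j=1..N. 1 / lam j))"
      by (simp add: g_def sum_subtractf flip: sum_distrib_left)
    then show ?thesis using s N(1) by (simp add: \<nu>_def field_simps)
  qed
  obtain \<delta> where \<delta>: "bij_betw \<delta> (UNIV :: 'm set) {1..CARD('m)}"
    using finite_same_card_bij[of "UNIV :: 'm set" "{1..CARD('m)}"] by auto
  \<comment> \<open>\<open>\<delta>\<close> numbers the output coordinates; those beyond
    \<open>N\<close> receive zero rows.\<close>
  define W :: "real^'n^'m" where "W = (\<chi> i. if \<delta> i \<le> N then sqrt (g (\<delta> i)) *\<^sub>R u (\<beta> (\<delta> i)) else 0)"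
  have \<delta>_ge: "1 \<le> \<delta> i" for i using \<delta> by (auto simp: bij_betw_def)
  have ortho: "u (\<beta> (\<delta> i)) \<bullet> u (\<beta> (\<delta> i')) = (if i = i' then 1 else 0)"
    if "\<delta> i \<le> N" "\<delta> i' \<le> N" for i i'
  proof -
    have "\<beta> (\<delta> i) = \<beta> (\<delta> i') \<longleftrightarrow> i = i'"
      using inj_on_eq_iff[OF bij_betw_imp_inj_on[OF \<beta>(1)], of "\<delta> i" "\<delta> i'"]
        inj_eq[OF bij_betw_imp_inj_on[OF \<delta>]] that N(2) \<delta>_ge[of i] \<delta>_ge[of i'] by simp
    then show ?thesis by (simp add: orthonormalD[OF u(1)])
  qed
  have "trace (transpose W ** W) = (\<Sum>i\<in>UNIV. if \<delta> i \<le> N then g (\<delta> i) else 0)"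
    unfolding trace_transpose_mult_rows
    by (intro sum.cong refl) (use g \<delta>_ge in \<open>auto simp: W_def ortho abs_of_nonneg simp flip: power2_eq_square\<close>)
  also have "\<dots> = (\<Sum>j=1..CARD('m). if j \<le> N then g j else 0)"
    by (rule sum.reindex_bij_betw[OF \<delta>])
  also have "\<dots> = (\<Sum>j=1..N. g j)"
    using N(3) by (intro sum.mono_neutral_cong_right) auto
  finally have tr: "trace (transpose W ** W) = F" unfolding sum_g .
  define \<kappa> where "\<kappa> j = (if j \<le> N then g j * lam j else 0)" for j
  have K: "(W ** Sx ** transpose W) $ i $ i' = (if i = i' then \<kappa> (\<delta> i) else 0)" for i i'
  proof -
    have "(W ** Sx ** transpose W) $ i $ i' = ((W ** Sx ** transpose W) *v axis i' 1) $ i"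
      by (simp add: matrix_vector_mul_component inner_axis)
    also have "\<dots> = W $ i \<bullet> (Sx *v (axis i' 1 v* W))"
      by (simp add: matrix_vector_mul_component flip: matrix_vector_mul_assoc)
    also have "axis i' 1 v* W = W $ i'"
      by (simp add: vec_eq_iff vector_matrix_mult_def axis_def if_distrib if_distribR cong: if_cong)
    finally have *: "(W ** Sx ** transpose W) $ i $ i' = W $ i \<bullet> (Sx *v W $ i')" .
    show ?thesis
    proof (cases "\<delta> i \<le> N \<and> \<delta> i' \<le> N")
      case True
      then have "d (\<beta> (\<delta> i')) = lam (\<delta> i')"
        using \<delta>_ge[of i'] N(2) by (intro \<beta>(2)) auto
      moreover have "g (\<delta> i) \<ge> 0"
        using g[of "\<delta> i"] True \<delta>_ge[of i] by simp
      ultimately show ?thesis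
        using True unfolding * by (auto simp: W_def matrix_vector_mult_scaleR u(2) ortho \<kappa>_def)
    next
      case False
      then show ?thesis unfolding * by (auto simp: W_def \<kappa>_def)
    qed
  qed
  have "det (output_cov Sx s W) = (\<Prod>i\<in>UNIV. \<kappa> (\<delta> i) + s)"
    by (subst det_diagonal) (simp_all add: output_cov_def K mat_def)
  also have "\<dots> = (\<Prod>j=1..CARD('m). \<kappa> j + s)"
    by (rule prod.reindex_bij_betw[OF \<delta>])
  finally have "det (output_cov Sx s W) / s ^ CARD('m) = (\<Prod>j=1..CARD('m). (\<kappa> j + s) / s)"
    by (simp add: prod_dividef)
  \<comment> \<open>Each active factor divided by \<open>lam j\<close> is the same number
    \<open>\<nu>\<close>, the equality case of AM-GM; idle rows contribute 1.\<close>
  also have "\<dots> = (\<Prod>j=1..N. \<nu> * lam j)"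
  proof (intro prod.mono_neutral_cong_right)
    fix j assume j: "j \<in> {1..N}"
    then show "(\<kappa> j + s) / s = \<nu> * lam j"
      using lam[OF j] s by (simp add: \<kappa>_def g_def field_simps)
  qed (use N(3) s in \<open>auto simp: \<kappa>_def\<close>)
  also have "\<dots> = \<nu> ^ N * (\<Prod>j=1..N. lam j)"
    by (simp add: prod.distrib)
  finally show thesis
    using that tr unfolding \<nu>_def by blast
qed

end

section \<open>The supremum from the matching bounds\<close>

theorem theorem1:
  fixes Sx :: "real^'n::finite^'n" and s2 F :: real and lam :: "nat \<Rightarrow> real"
  assumes "pos_def_matrix Sx"
    and "\<And>t. det (Sx - mat t) = (\<Prod>i=1..CARD('n). (lam i - t))"
    and "\<And>i j. 1 \<le> i \<Longrightarrow> i \<le> j \<Longrightarrow> j \<le> CARD('n) \<Longrightarrow> lam j \<le> lam i"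
    and "lam (CARD('n)) > 0"
    and "s2 > 0"
    and "F \<ge> rho s2 lam (min CARD('n) CARD('m))"
  shows "MMI TYPE('m::finite) Sx s2 F =
    ereal (real (min CARD('n) CARD('m)) / 2
             * ln ((F + s2 * (\<Sum>i=1..min CARD('n) CARD('m). 1 / lam i))
                   / (s2 * real (min CARD('n) CARD('m))))
           + 1/2 * ln (\<Prod>i=1..min CARD('n) CARD('m). lam i))"
proof -
  obtain u d where u: "orthonormal u" "\<And>i. Sx *v u i = d i *\<^sub>R u i"
    using symmetric_matrix_eigenbasis[of Sx] assms(1) by (auto simp: pos_def_matrix_def)
  obtain \<beta> where \<beta>: "bij_betw \<beta> {1..CARD('n)} (UNIV :: 'n set)" "\<And>j. j \<in> {1..CARD('n)} \<Longrightarrow> d (\<beta> j) = lam j"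
    using eigenvalue_enumeration[OF u assms(2)] by metis
  note ctx = assms(1,5) u \<beta> assms(3)
  define N where "N = min CARD('n) CARD('m)"
  define X where "X = (F + s2 * (\<Sum>i=1..N. 1 / lam i)) / (s2 * real N)"
  define P where "P = (\<Prod>i=1..N. lam i)"
  have N: "N \<ge> 1" "N \<le> CARD('n)" by (simp_all add: N_def Suc_le_eq)
  have lam: "lam j > 0" if "j \<in> {1..N}" for j
    using lam_pos[OF ctx] that N(2) by simp
  then have P: "P > 0" unfolding P_def by (intro prod_pos) auto
  have pos: "det (output_cov Sx s2 W) / s2 ^ CARD('m) > 0" for W :: "real^'n^'m"
    using pos_def_det_pos[OF pos_def_output_cov[OF assms(1,5), of W]] assms(5) by simp
  obtain W0 :: "real^'n^'m" where W0: "trace (transpose W0 ** W0) = F"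
      "det (output_cov Sx s2 W0) / s2 ^ CARD('m) = X ^ N * P"
    using det_output_cov_attained[OF ctx assms(6)] unfolding X_def P_def N_def by blast
  \<comment> \<open>The power bound again, now giving \<open>X > 0\<close> so that the logarithm of
    the product can be split.\<close>
  have "1 / lam N \<le> X"
    using assms(5,6) N(1) by (simp add: X_def rho_def field_simps flip: N_def)
  then have X: "X > 0"
    using lam[of N] N(1) by (smt (verit) atLeastAtMost_iff divide_pos_pos order_refl)
  have val: "1/2 * ln (X ^ N * P) = real N / 2 * ln X + 1/2 * ln P"
    using X P by (simp add: ln_mult ln_realpow algebra_simps)
  have "MMI TYPE('m) Sx s2 F = ereal (1/2 * ln (X ^ N * P))"
    unfolding MMI_def
  proof (intro antisym SUP_least)
    fix Wb :: "(real^'n^'m) \<times> (real^'m)"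
    assume "Wb \<in> {(W, b). trace (transpose W ** W) \<le> F}"
    then have "trace (transpose (fst Wb) ** fst Wb) \<le> F" by auto
    from det_output_cov_le[OF ctx this]
    have "det (output_cov Sx s2 (fst Wb)) / s2 ^ CARD('m) \<le> X ^ N * P"
      by (simp add: X_def P_def N_def)
    then show "ereal (MI_Wb Sx s2 (fst Wb) (snd Wb)) \<le> ereal (1/2 * ln (X ^ N * P))"
      using pos[of "fst Wb"] by (simp add: MI_Wb_eq[OF assms(1,5)])
  next
    \<comment> \<open>The supremum is attained at \<open>W0\<close>; the value in
      \<open>MI_Wb_eq\<close> does not depend on the offset, so zero is chosen.\<close>
    have "ereal (1/2 * ln (X ^ N * P)) = ereal (MI_Wb Sx s2 (fst (W0, 0::real^'m)) (snd (W0, 0)))"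
      by (simp add: MI_Wb_eq[OF assms(1,5)] W0(2))
    also have "\<dots> \<le> (SUP Wb \<in> {(W :: real^'n^'m, b :: real^'m). trace (transpose W ** W) \<le> F}. ereal (MI_Wb Sx s2 (fst Wb) (snd Wb)))"
      by (rule SUP_upper) (simp add: W0(1))
    finally show "ereal (1/2 * ln (X ^ N * P)) \<le> (SUP Wb \<in> {(W :: real^'n^'m, b :: real^'m). trace (transpose W ** W) \<le> F}. ereal (MI_Wb Sx s2 (fst Wb) (snd Wb)))" .
  qed
  then show ?thesis
    unfolding val by (simp add: X_def P_def N_def)
qed

end
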